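(* Suppose all agents have identical uncertainty classes $(\mathcal{P}_0,\mathcal{P}_1)$ with least favorable distributions $(Q_0,Q_1)$, and that every agent $k>1$ uses the same decision rule $\phi$, agent 1 using the optimal rule $\phi_1$ that minimizes $P_1^{\mathrm{SL}}(\cdot)$. Assume that the likelihood ratio of $Y_k$ is continuous. Then $\phi_*=\arg\min_\phi P_{\max}^{\mathrm{SL}}(\phi)$ is a randomized likelihood ratio test between $Q_0$ and $Q_1$, and $$P_{\max}^{\mathrm{SL}}(\phi_* )=\max\left\{P_2^{\mathrm{SL}}(\phi_*\mid\phi_1),\ P_\infty^{\mathrm{DD}}(\phi_* )\right\}.$$
   Context: Infinite tandem network: agents $1,2,\dots$; the true hypothesis $H$ is $H_i$ with prior probability $\pi_i\in(0,1)$, $i=0,1$, $\pi_0+\pi_1=1$. Conditioned on $H=H_i$, agent $k$ observes $Y_k$ in a measurable space $(\mathcal{Y},\mathcal{A})$ with (unknown) distribution in the uncertainty class $\mathcal{P}_i=\{(1-\epsilon_i)P_i^*+\epsilon_iR : R\in\mathcal{R}\}$ (the same for all agents), where $\mathcal{R}$ is the set of all probability measures on $(\mathcal{Y},\mathcal{A})$, $P_i^*\in\mathcal{R}$ is the nominal distribution, and the contamination $\epsilon_i\in[0,1)$ is small enough that $\mathcal{P}_0,\mathcal{P}_1$ are disjoint. All distributions in $\mathcal{P}_0$ and $\mathcal{P}_1$ are assumed absolutely continuous with respect to one another. Given $H$, the observations are independent across agents (different agents may have different laws within the class). $\mathcal{P}_i^k$ is the set of product laws $P_i^{(k)}=P_{i,1}\times\cdots\times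 P_{i,k}$ with all $P_{i,j}\in\mathcal{P}_i$. Agent 1 decides $U_1=\phi_1(Y_1)\in\{0,1\}$; agent $k\ge2$ decides $U_k=\phi(Y_k,U_{k-1})\in\{0,1\}$, where rules may be randomized. $(\phi_1,\phi)$ denotes this sequence of rules. $P_{e,k}((\phi_1,\phi),P_0^{(k)},P_1^{(k)})=\pi_0P_0^{(k)}(U_k=1)+\pi_1P_1^{(k)}(U_k=0)$. $P_1^{\mathrm{SL}}(\phi_1)=\sup_{(P_0,P_1)\in\mathcal{P}_0\times\mathcal{P}_1}P_{e,1}(\phi_1,P_0,P_1)$. For $k\ge2$, $P_k^{\mathrm{SL}}(\phi\mid(\phi_1,\phi))=P_k^{\mathrm{DD}}(\phi_1,\phi)=\sup_{(P_0^{(k)},P_1^{(k)})\in\mathcal{P}_0^k\times\mathcal{P}_1^k}P_{e,k}((\phi_1,\phi),P_0^{(k)},P_1^{(k)})$ (for $k=2$ written $P_2^{\mathrm{SL}}(\phi\mid\phi_1)$). $P_{\max}^{\mathrm{SL}}(\phi)=\sup_{k\ge2}P_k^{\mathrm{SL}}(\phi\mid(\phi_1,\phi))$ and $P_\infty^{\mathrm{DD}}(\phi)=\lim_{k\to\infty}P_k^{\mathrm{DD}}(\phi_1,\phi)$. Least favorable distributions $(Q_0,Q_1)$ of $(\mathcal{P}_0,\mathcal{P}_1)$: with $p_i^*$ the density of $P_i^*$ with respect to a common measure, they have densities $q_0=(1-\epsilon_0)p_0^*$ where $p_1^*/p_0^*<c''$, $q_0=(1-\epsilon_0)p_1^*/c''$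 where $p_1^*/p_0^*\ge c''$; $q_1=(1-\epsilon_1)p_1^*$ where $p_1^*/p_0^*>c'$, $q_1=c'(1-\epsilon_1)p_0^*$ where $p_1^*/p_0^*\le c'$, with $0\le c'<c''\le\infty$ determined so that $q_0,q_1$ are probability densities. $l^*(y)=q_1(y)/q_0(y)$. A randomized likelihood ratio test between $Q_0$ and $Q_1$ is a rule of the form: $u_k=0$ if $l^*(Y_k)<t_1$; $u_k=A$ if $l^*(Y_k)=t_1$; $u_k=u_{k-1}$ if $t_1<l^*(Y_k)<t_0$; $u_k=B$ if $l^*(Y_k)=t_0$; $u_k=1$ if $l^*(Y_k)>t_0$. Here $A$ equals $0$ with probability $p$ and $u_{k-1}$ with probability $1-p$; $B$ equals $u_{k-1}$ with probability $q$ and $1$ with probability $1-q$; $t_0,t_1,p,q$ are constants. *)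

theory Defs
  imports "HOL-Probability.Probability"
begin

text \<open>
  Decisions are Booleans: \<open>True\<close> stands for deciding 1 and \<open>False\<close> for deciding 0. A randomized
  rule returns the distribution of the decision given its inputs; randomization is private, i.e.
  independent across agents and of the observations.
\<close>

definition rules1 :: "'a measure \<Rightarrow> ('a \<Rightarrow> bool pmf) set" where
  "rules1 M = {\<phi>1. (\<lambda>y. pmf (\<phi>1 y) True) \<in> borel_measurable M}"

definition rules :: "'a measure \<Rightarrow> ('a \<Rightarrow> bool \<Rightarrow> bool pmf) set" where
  "rules M = {\<phi>. \<forall>u. (\<lambda>y. pmf (\<phi> y u) True) \<in> borel_measurable M}"

definition contamination_class :: "'a measure \<Rightarrow> real \<Rightarrow> 'a measure \<Rightarrow> 'a measure set" where
  "contamination_class M \<epsilon> Pstar =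
     {P. prob_space P \<and> sets P = sets M \<and>
         (\<exists>R. prob_space R \<and> sets R = sets M \<and>
              (\<forall>A\<in>sets M. measure P A = (1 - \<epsilon>) * measure Pstar A + \<epsilon> * measure R A))}"

definition product_class :: "'a measure set \<Rightarrow> nat \<Rightarrow> (nat \<Rightarrow> 'a) measure set" where
  "product_class C k = {PiM {1..k} P | P. \<forall>j\<in>{1..k}. P j \<in> C}"

text \<open>
  Conditional distribution of the decision of agent \<open>k\<close> given the observations
  \<open>y 1, \<dots>, y k\<close>. Agents are numbered from 1; the value for \<open>k = 0\<close> is never used.
\<close>

fun decision :: "('a \<Rightarrow> bool pmf) \<Rightarrow> ('a \<Rightarrow> bool \<Rightarrow> bool pmf) \<Rightarrow> nat \<Rightarrow> (nat \<Rightarrow> 'a) \<Rightarrow> bool pmf" where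
  "decision \<phi>1 \<phi> (Suc 0) y = \<phi>1 (y 1)"
| "decision \<phi>1 \<phi> (Suc (Suc k)) y =
     bind_pmf (decision \<phi>1 \<phi> (Suc k) y) (\<lambda>u. \<phi> (y (Suc (Suc k))) u)"

definition error1 ::
  "real \<Rightarrow> real \<Rightarrow> ('a \<Rightarrow> bool pmf) \<Rightarrow> 'a measure \<Rightarrow> 'a measure \<Rightarrow> real" where
  "error1 \<pi>0 \<pi>1 \<phi>1 P0 P1 =
     \<pi>0 * (LINT y|P0. pmf (\<phi>1 y) True) + \<pi>1 * (LINT y|P1. pmf (\<phi>1 y) False)"

definition error_prob ::
  "real \<Rightarrow> real \<Rightarrow> ('a \<Rightarrow> bool pmf) \<Rightarrow> ('a \<Rightarrow> bool \<Rightarrow> bool pmf) \<Rightarrow> nat \<Rightarrow>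
     (nat \<Rightarrow> 'a) measure \<Rightarrow> (nat \<Rightarrow> 'a) measure \<Rightarrow> real" where
  "error_prob \<pi>0 \<pi>1 \<phi>1 \<phi> k P0k P1k =
     \<pi>0 * (LINT y|P0k. pmf (decision \<phi>1 \<phi> k y) True) +
     \<pi>1 * (LINT y|P1k. pmf (decision \<phi>1 \<phi> k y) False)"

definition P1_SL ::
  "real \<Rightarrow> real \<Rightarrow> 'a measure set \<Rightarrow> 'a measure set \<Rightarrow> ('a \<Rightarrow> bool pmf) \<Rightarrow> real" where
  "P1_SL \<pi>0 \<pi>1 C0 C1 \<phi>1 = (SUP (P0, P1)\<in>C0 \<times> C1. error1 \<pi>0 \<pi>1 \<phi>1 P0 P1)"

definition P_DD ::
  "real \<Rightarrow> real \<Rightarrow> 'a measure set \<Rightarrow> 'a measure set \<Rightarrow>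
     ('a \<Rightarrow> bool pmf) \<Rightarrow> ('a \<Rightarrow> bool \<Rightarrow> bool pmf) \<Rightarrow> nat \<Rightarrow> real" where
  "P_DD \<pi>0 \<pi>1 C0 C1 \<phi>1 \<phi> k =
     (SUP (P0k, P1k)\<in>product_class C0 k \<times> product_class C1 k.
        error_prob \<pi>0 \<pi>1 \<phi>1 \<phi> k P0k P1k)"

text \<open>For \<open>k \<ge> 2\<close> the social learning error of agent \<open>k\<close> is by definition \<open>P_DD\<close>.\<close>

abbreviation P_SL ::
  "real \<Rightarrow> real \<Rightarrow> 'a measure set \<Rightarrow> 'a measure set \<Rightarrow>
     ('a \<Rightarrow> bool pmf) \<Rightarrow> ('a \<Rightarrow> bool \<Rightarrow> bool pmf) \<Rightarrow> nat \<Rightarrow> real" where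
  "P_SL \<equiv> P_DD"

definition Pmax_SL ::
  "real \<Rightarrow> real \<Rightarrow> 'a measure set \<Rightarrow> 'a measure set \<Rightarrow>
     ('a \<Rightarrow> bool pmf) \<Rightarrow> ('a \<Rightarrow> bool \<Rightarrow> bool pmf) \<Rightarrow> real" where
  "Pmax_SL \<pi>0 \<pi>1 C0 C1 \<phi>1 \<phi> = (SUP k\<in>{2..}. P_SL \<pi>0 \<pi>1 C0 C1 \<phi>1 \<phi> k)"

definition Pinf_DD ::
  "real \<Rightarrow> real \<Rightarrow> 'a measure set \<Rightarrow> 'a measure set \<Rightarrow>
     ('a \<Rightarrow> bool pmf) \<Rightarrow> ('a \<Rightarrow> bool \<Rightarrow> bool pmf) \<Rightarrow> real" where
  "Pinf_DD \<pi>0 \<pi>1 C0 C1 \<phi>1 \<phi> = lim (\<lambda>k. P_DD \<pi>0 \<pi>1 C0 C1 \<phi>1 \<phi> k)"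

text \<open>
  Densities of the least favorable distributions; \<open>p0\<close> and \<open>p1\<close> are the nominal densities, meant to
  be everywhere positive so that the quotients are genuine. If \<open>c''\<close> is infinite, the second
  branch of \<open>lfd_q0\<close> is never taken.
\<close>

definition lfd_q0 :: "real \<Rightarrow> ereal \<Rightarrow> ('a \<Rightarrow> real) \<Rightarrow> ('a \<Rightarrow> real) \<Rightarrow> 'a \<Rightarrow> real" where
  "lfd_q0 \<epsilon>0 c'' p0 p1 y =
     (if ereal (p1 y / p0 y) < c'' then (1 - \<epsilon>0) * p0 y
      else (1 - \<epsilon>0) * p1 y / real_of_ereal c'')"

definition lfd_q1 :: "real \<Rightarrow> real \<Rightarrow> ('a \<Rightarrow> real) \<Rightarrow> ('a \<Rightarrow> real) \<Rightarrow> 'a \<Rightarrow> real" where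
  "lfd_q1 \<epsilon>1 c' p0 p1 y =
     (if p1 y / p0 y > c' then (1 - \<epsilon>1) * p1 y
      else c' * (1 - \<epsilon>1) * p0 y)"

text \<open>
  Randomized likelihood ratio tests between the distributions with densities \<open>q0\<close> and \<open>q1\<close>.
  An infinite threshold means that the corresponding region is empty.
\<close>

definition randomized_LRT ::
  "'a measure \<Rightarrow> ('a \<Rightarrow> real) \<Rightarrow> ('a \<Rightarrow> real) \<Rightarrow> ('a \<Rightarrow> bool \<Rightarrow> bool pmf) \<Rightarrow> bool" where
  "randomized_LRT M q0 q1 \<phi> \<longleftrightarrow>
     (\<exists>(t1::ereal) (t0::ereal) (p::real) (q::real).
        t1 < t0 \<and> p \<in> {0..1} \<and> q \<in> {0..1} \<and>
        (\<forall>y\<in>space M. \<forall>u. let l = ereal (q1 y / q0 y) in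
           (l < t1 \<longrightarrow> \<phi> y u = return_pmf False) \<and>
           (l = t1 \<longrightarrow> \<phi> y u = map_pmf (\<lambda>b. if b then False else u) (bernoulli_pmf p)) \<and>
           (t1 < l \<and> l < t0 \<longrightarrow> \<phi> y u = return_pmf u) \<and>
           (l = t0 \<longrightarrow> \<phi> y u = map_pmf (\<lambda>b. if b then u else True) (bernoulli_pmf q)) \<and>
           (l > t0 \<longrightarrow> \<phi> y u = return_pmf True)))"

end

(*
  Replace every law by the least favorable pair (Q0, Q1). The probability that agent k decides 1
  then follows an affine recursion under each hypothesis, so a rule enters only through two points
  of the ROC region of (Q0, Q1), one for each value of the previous decision, and the error of
  agent k is a constant plus a combination of two geometric sequences. For a threshold rule these
  Q-errors are the worst-case errors; for any rule they are lower bounds.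

  Copying the previous decision achieves the error e1 of agent 1, so only rules with
  agent-2 error below e1 matter. Such a rule reacts monotonically to the previous decision, hence
  replacing its two tests by Neyman-Pearson tests of the same levels improves all Q-errors.
  If the error does not increase from agent 1 to agent 2, its increments change sign at most once,
  and the supremum over k is attained at k = 2 or in the limit. Minimizers exist by compactness.
  An arbitrary minimizer violating the formula would be beaten by its Neyman-Pearson improvement.
*)
theory Submission
  imports Defs
begin

section \<open>Two-state affine recursions\<close>

text \<open>Two obstacles shape the proof. \<open>randomized_LRT\<close> demands
  \<open>t1 < t0\<close>, but the most powerful tests of two levels may share one threshold:
  clipping can give \<open>q1 / q0\<close> atoms at its extreme values even if
  \<open>p1 / p0\<close> has none. Such a pair is repaired by a test with threshold 1, a value that
  carries no mass and at which the observation favors neither hypothesis. Second, the formula is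
  claimed for every minimizer, and its limit must first be shown to exist. For an arbitrary rule the
  worst laws are not known explicitly, so the worst-case errors of successive agents are compared
  directly: every law of a class contains a fixed fraction of the nominal law, so the influence of
  early decisions dies out uniformly, except for rules that almost surely copy or negate.
  Compactness is applied to four numbers, the sizes and powers of the two tests, and not to rules: a
  limit of such points is dominated by the most powerful tests of the limiting sizes. A
  Neyman-Pearson improvement keeps the sizes, so it leaves the recursion under Q0 untouched.\<close>

primrec markov :: "real \<Rightarrow> real \<Rightarrow> real \<Rightarrow> nat \<Rightarrow> real" where
  "markov a b x 0 = x"
| "markov a b x (Suc n) = (1 - markov a b x n) * a + markov a b x n * b"

lemma convex_unit:
  fixes a b x :: real
  assumes "a \<in> {0..1}" "b \<in> {0..1}" "x \<in> {0..1}"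
  shows "(1 - x) * a + x * b \<in> {0..1}"
proof -
  have "(1 - x) * a + x * b \<le> (1 - x) * 1 + x * 1"
    using assms by (intro add_mono mult_left_mono) auto
  moreover have "0 \<le> (1 - x) * a + x * b"
    using assms by auto
  ultimately show ?thesis by auto
qed

text \<open>It is enough that one of the two maps is increasing: the state moves along that map, and
  the maps are then compared at a fixed state. The two alternatives serve the two hypotheses, since
  the coefficients known to be ordered, those of a threshold rule under the least favorable law, are
  the upper ones under the first hypothesis and the lower ones under the second.\<close>

lemma affine_mono:
  fixes a b x :: real
  assumes "a \<le> b \<or> a' \<le> b'" "x \<le> y" "a \<le> a'" "b \<le> b'" "x \<in> {0..1}" "y \<in> {0..1}"
  shows "(1 - x) * a + x * b \<le> (1 - y) * a' + y * b'"
proof -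
  have step: "(1 - x) * c + x * d \<le> (1 - y) * c + y * d" if "c \<le> d" for c d
  proof -
    have "(y - x) * c \<le> (y - x) * d"
      using assms that by (intro mult_left_mono) auto
    thus ?thesis by (simp add: algebra_simps)
  qed
  have "(1 - z) * a + z * b \<le> (1 - z) * a' + z * b'" if "z \<in> {0..1}" for z
    using assms that by (intro add_mono mult_left_mono) auto
  from assms(1) step this[OF assms(5)] this[OF assms(6)] show ?thesis
    by (meson order_trans)
qed

lemma markov_unit:
  assumes "a \<in> {0..1}" "b \<in> {0..1}" "x \<in> {0..1}"
  shows "markov a b x n \<in> {0..1}"
proof (induction n)
  case (Suc n)
  show ?case using convex_unit[OF assms(1,2) Suc] by simp
qed (use assms in auto)

lemma markov_mono:
  assumes "a \<le> b \<or> a' \<le> b'" "a \<le> a'" "b \<le> b'"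
    and "a \<in> {0..1}" "b \<in> {0..1}" "a' \<in> {0..1}" "b' \<in> {0..1}" "x \<in> {0..1}"
  shows "markov a b x n \<le> markov a' b' x n"
proof (induction n)
  case (Suc n)
  show ?case
    using affine_mono[OF assms(1) Suc assms(2,3) markov_unit[OF assms(4,5,8)] markov_unit[OF assms(6-8)]]
    by simp
qed simp

lemma markov_diff:
  "markov a b x (Suc n) - markov a b x n = (b - a) ^ n * (markov a b x 1 - x)"
proof (induction n)
  case (Suc n)
  have "markov a b x (Suc (Suc n)) - markov a b x (Suc n)
      = (b - a) * (markov a b x (Suc n) - markov a b x n)"
    by (simp add: algebra_simps)
  thus ?case using Suc by simp
qed simp

lemma markov_copy [simp]: "markov 0 1 x n = x"
  by (induction n) auto

text \<open>Exchanging the two decisions turns results about keeping a 1 into results about keeping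
  a 0.\<close>

lemma markov_reflect: "1 - markov a b x n = markov (1 - b) (1 - a) (1 - x) n"
proof (induction n)
  case (Suc n)
  show ?case by (simp flip: Suc add: algebra_simps)
qed simp

text \<open>Increasing the probability of keeping the decision 1 pays off at every later time if it
  does so in a single step from every state on the trajectory.\<close>

lemma markov_raise_weighted:
  fixes p q :: real
  assumes pq: "0 \<le> p" "0 \<le> q"
    and b: "a \<le> b" "b \<le> b'" "b' - b \<le> d' - d" "b' - a \<le> d' - c"
    and le: "\<And>n. p * markov a b x n \<le> q * markov c d w n"
    and xw: "\<And>n. 0 \<le> markov a b x n" "\<And>n. 0 \<le> markov c d w n"
  shows "p * (markov a b' x n - markov a b x n) \<le> q * (markov c d' w n - markov c d w n) \<and>
    markov a b x n \<le> markov a b' x n"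
proof (induction n)
  case (Suc n)
  define X where "X = markov a b' x n - markov a b x n"
  define W where "W = markov c d' w n - markov c d w n"
  have IH: "p * X \<le> q * W" "0 \<le> X" using Suc by (auto simp: X_def W_def)
  have X: "markov a b' x (Suc n) - markov a b x (Suc n) = (b' - b) * markov a b x n + (b' - a) * X"
    by (simp add: X_def algebra_simps)
  have W: "markov c d' w (Suc n) - markov c d w (Suc n) = (d' - d) * markov c d w n + (d' - c) * W"
    by (simp add: W_def algebra_simps)
  have "(b' - b) * (p * markov a b x n) \<le> (d' - d) * (q * markov c d w n)"
    using b pq xw(1)[of n] by (intro mult_mono[OF _ le]) auto
  moreover have "(b' - a) * (p * X) \<le> (d' - c) * (q * W)"
    using b pq IH by (intro mult_mono[OF _ IH(1)]) auto
  ultimately have "p * (markov a b' x (Suc n) - markov a b x (Suc n))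
      \<le> q * (markov c d' w (Suc n) - markov c d w (Suc n))"
    unfolding X W by (simp add: algebra_simps)
  moreover have "0 \<le> markov a b' x (Suc n) - markov a b x (Suc n)"
    unfolding X using b IH xw(1)[of n] by (intro add_nonneg_nonneg mult_nonneg_nonneg) auto
  ultimately show ?case by linarith
qed simp

lemma tendsto_markov:
  assumes "(a \<longlongrightarrow> a') F" "(b \<longlongrightarrow> b') F"
  shows "((\<lambda>i. markov (a i) (b i) x n) \<longlongrightarrow> markov a' b' x n) F"
  by (induction n) (auto intro!: tendsto_intros assms)

text \<open>The increments are a constant times powers of \<open>b - a\<close>, hence of one sign,
  and the sequence is bounded. This covers slope 1, where nothing contracts.\<close>

lemma convergent_markov:
  assumes "a \<le> b" "a \<in> {0..1}" "b \<in> {0..1}" "x \<in> {0..1}"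
  shows "convergent (markov a b x)"
proof (rule Bseq_monoseq_convergent)
  show "Bseq (markov a b x)"
    using markov_unit[OF assms(2-4)] by (intro BseqI'[of _ 1]) auto
  have *: "markov a b x n \<le> markov a b x (Suc n) \<longleftrightarrow> 0 \<le> (b - a) ^ n * (markov a b x 1 - x)"
    "markov a b x n \<ge> markov a b x (Suc n) \<longleftrightarrow> 0 \<ge> (b - a) ^ n * (markov a b x 1 - x)" for n
    using markov_diff[of a b x n] by linarith+
  show "monoseq (markov a b x)"
  proof (cases "x \<le> markov a b x 1")
    case True
    thus ?thesis
      using assms(1) unfolding monoseq_Suc * by auto
  next
    case False
    hence "(b - a) ^ n * (markov a b x 1 - x) \<le> 0" for n
      using assms(1) by (intro mult_nonneg_nonpos) auto
    thus ?thesis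
      unfolding monoseq_Suc * by auto
  qed
qed

text \<open>A positive value at time \<open>m\<close> requires a positive coefficient; as the
  coefficients sum to at most 0, its base must be the larger one. From then on each value is at
  least that base times its predecessor.\<close>

lemma exp_sum_sign_stable:
  fixes p q r s :: real
  assumes "p + q \<le> 0" "0 \<le> r" "0 \<le> s" "0 < p * r ^ m + q * s ^ m" "m \<le> n"
  shows "0 \<le> p * r ^ n + q * s ^ n"
proof -
  have main: "0 \<le> p * r ^ n + q * s ^ n"
    if *: "p + q \<le> 0" "0 \<le> r" "0 \<le> s" "0 < p * r ^ m + q * s ^ m" "0 < p" for p q r s :: real
  proof -
    have q: "q \<le> 0" using * by linarith
    have "s \<le> r"
    proof (rule ccontr)
      assume "\<not> s \<le> r"
      hence "p * r ^ m \<le> p * s ^ m"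
        using * by (intro mult_left_mono power_mono) auto
      hence "p * r ^ m + q * s ^ m \<le> (p + q) * s ^ m"
        by (simp add: algebra_simps)
      also have "\<dots> \<le> 0"
        using * by (intro mult_nonpos_nonneg) auto
      finally show False using * by linarith
    qed
    show ?thesis
      using \<open>m \<le> n\<close>
    proof (induction n rule: dec_induct)
      case (step k)
      have "q * s ^ k * s \<ge> q * s ^ k * r"
        using q * \<open>s \<le> r\<close> by (intro mult_left_mono_neg mult_nonpos_nonneg) auto
      hence "(p * r ^ k + q * s ^ k) * r \<le> p * r ^ Suc k + q * s ^ Suc k"
        by (simp add: algebra_simps)
      moreover have "0 \<le> (p * r ^ k + q * s ^ k) * r"
        using step * by auto
      ultimately show ?case by linarith
    qed (use * in auto)
  qed
  have "\<not> (p \<le> 0 \<and> q \<le> 0)"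
  proof
    assume "p \<le> 0 \<and> q \<le> 0"
    hence "p * r ^ m \<le> 0" "q * s ^ m \<le> 0"
      using assms by (auto intro!: mult_nonpos_nonneg)
    thus False using assms by linarith
  qed
  thus ?thesis
    using main[of p q r s] main[of q p s r] assms by (auto simp: add.commute)
qed

text \<open>Once \<open>e\<close> increases it never decreases again, as \<open>p + q \<le> 0\<close> excludes the other order of signs.\<close>

lemma exp_sum_increments_bound:
  fixes e :: "nat \<Rightarrow> real"
  assumes inc: "\<And>n. e (Suc n) - e n = p * r ^ n + q * s ^ n"
    and "0 \<le> r" "0 \<le> s" "e 1 \<le> e 0" "e \<longlonglongrightarrow> l" "1 \<le> n"
  shows "e n \<le> max (e 1) l"
proof (cases "\<exists>j. 1 \<le> j \<and> j < n \<and> e j < e (Suc j)")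
  case True
  then obtain j where j: "j < n" "e j < e (Suc j)" by auto
  have pq: "p + q \<le> 0" using inc[of 0] assms(4) by simp
  have "0 < p * r ^ j + q * s ^ j" using inc[of j] j by linarith
  hence up: "e i \<le> e (Suc i)" if "j \<le> i" for i
    using exp_sum_sign_stable[OF pq assms(2,3) _ that] inc[of i] by simp
  have "e n \<le> l"
  proof (rule LIMSEQ_le_const[OF assms(5)], intro exI[of _ n] allI impI)
    fix i assume "n \<le> i"
    thus "e n \<le> e i"
    proof (induction i rule: dec_induct)
      case (step i)
      thus ?case using up[of i] j(1) by linarith
    qed simp
  qed
  thus ?thesis by simp
next
  case False
  have "k \<le> n \<Longrightarrow> e k \<le> e 1" if "1 \<le> k" for k
    using that
  proof (induction k rule: dec_induct)
    case (step k)
    hence "e (Suc k) \<le> e k" using False by (meson Suc_le_eq linorder_not_less)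
    thus ?case using step by simp
  qed simp
  thus ?thesis using assms(6) by (simp add: le_max_iff_disj)
qed

lemma geometric_increments_convergent:
  fixes u :: "nat \<Rightarrow> real"
  assumes "\<And>n. \<bar>u (Suc n) - u n\<bar> \<le> L ^ n" "0 \<le> L" "L < 1"
  shows "convergent u"
proof -
  have "summable (\<lambda>n. u (Suc n) - u n)"
    using assms by (intro summable_comparison_test'[OF summable_geometric[of L], of 0]) auto
  hence "(\<lambda>n. u 0 + (\<Sum>i<n. u (Suc i) - u i)) \<longlonglongrightarrow> u 0 + (\<Sum>i. u (Suc i) - u i)"
    by (intro tendsto_intros summable_LIMSEQ)
  thus ?thesis by (auto simp: sum_lessThan_telescope convergent_def)
qed

section \<open>The law of the decisions\<close>

lemma pmf_bool_cong:
  fixes p q :: "bool pmf"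
  assumes "pmf p True = pmf q True"
  shows "p = q"
  using assms by (intro pmf_eqI) (metis (full_types) pmf_False_conv_True)

lemma pmf_bind_bool:
  "pmf (bind_pmf N f) b = pmf N False * pmf (f False) b + pmf N True * pmf (f True) b"
  for N :: "bool pmf"
  by (simp add: pmf_bind integral_measure_pmf_real[where A = UNIV] UNIV_bool algebra_simps)

lemma decision_fun_upd:
  "k \<noteq> 0 \<Longrightarrow> k < j \<Longrightarrow> decision \<phi>1 \<phi> k (y(j := a)) = decision \<phi>1 \<phi> k y"
  by (induction \<phi>1 \<phi> k y rule: decision.induct) auto

lemma decision_measurable:
  assumes "\<phi>1 \<in> rules1 M" "\<phi> \<in> rules M" "{1..Suc n} \<subseteq> I" "\<And>i. i \<in> I \<Longrightarrow> sets (P i) = sets M"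
  shows "(\<lambda>y. pmf (decision \<phi>1 \<phi> (Suc n) y) True) \<in> borel_measurable (PiM I P)"
  using assms(3)
proof (induction n)
  case 0
  have "(\<lambda>y. y 1) \<in> measurable (PiM I P) (P 1)"
    using 0 by (intro measurable_component_singleton) auto
  also have "measurable (PiM I P) (P 1) = measurable (PiM I P) M"
    using 0 assms(4)[of 1] by (intro measurable_cong_sets) auto
  finally have "(\<lambda>y. y 1) \<in> measurable (PiM I P) M" .
  moreover have "(\<lambda>y. pmf (\<phi>1 y) True) \<in> borel_measurable M"
    using assms(1) by (auto simp: rules1_def)
  ultimately show ?case
    using measurable_compose by fastforce
next
  case (Suc n)
  have "(\<lambda>y. y (Suc (Suc n))) \<in> measurable (PiM I P) (P (Suc (Suc n)))"
    using Suc by (intro measurable_component_singleton) auto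
  also have "measurable (PiM I P) (P (Suc (Suc n))) = measurable (PiM I P) M"
    using Suc.prems by (intro measurable_cong_sets assms(4) refl) auto
  finally have [measurable]: "(\<lambda>y. y (Suc (Suc n))) \<in> measurable (PiM I P) M" .
  have [measurable]: "(\<lambda>y. pmf (\<phi> y u) True) \<in> borel_measurable M" for u
    using assms(2) by (auto simp: rules_def)
  have [measurable]: "(\<lambda>y. pmf (decision \<phi>1 \<phi> (Suc n) y) True) \<in> borel_measurable (PiM I P)"
    by (intro Suc.IH) (use Suc.prems in auto)
  show ?case
    by (simp add: pmf_bind_bool pmf_False_conv_True)
qed

text \<open>Agents are numbered from 1, so \<open>traj \<phi>1 \<phi> P n\<close> belongs to agent \<open>n + 1\<close>.\<close>

primrec traj :: "('a \<Rightarrow> bool pmf) \<Rightarrow> ('a \<Rightarrow> bool \<Rightarrow> bool pmf) \<Rightarrow> (nat \<Rightarrow> 'a measure) \<Rightarrow> nat \<Rightarrow> real" where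
  "traj \<phi>1 \<phi> P 0 = (LINT y|P 1. pmf (\<phi>1 y) True)"
| "traj \<phi>1 \<phi> P (Suc n) =
     (1 - traj \<phi>1 \<phi> P n) * (LINT y|P (Suc (Suc n)). pmf (\<phi> y False) True) +
     traj \<phi>1 \<phi> P n * (LINT y|P (Suc (Suc n)). pmf (\<phi> y True) True)"

text \<open>A non-integrable integrand has integral 0 by convention, which also lies in the unit
  interval.\<close>

lemma (in prob_space) integral_pmf_unit: "(LINT y|M. pmf (f y) b) \<in> {0..1}"
proof -
  have "(LINT y|M. pmf (f y) b) \<le> 1"
  proof (cases "integrable M (\<lambda>y. pmf (f y) b)")
    case True
    thus ?thesis by (intro integral_le_const) (auto simp: pmf_le_1)
  qed (simp add: not_integrable_integral_eq)
  thus ?thesis by auto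
qed

lemma traj_unit:
  assumes "\<And>j. prob_space (P j)"
  shows "traj \<phi>1 \<phi> P n \<in> {0..1}"
proof (induction n)
  case 0
  show ?case using prob_space.integral_pmf_unit[OF assms, of 1 \<phi>1 True] by simp
next
  case (Suc n)
  show ?case
    using convex_unit[OF prob_space.integral_pmf_unit[OF assms] prob_space.integral_pmf_unit[OF assms] Suc]
    by simp
qed

text \<open>Fubini in the coordinate of the last agent: the previous decision does not depend on it,
  so the inner integral is affine in the probability of that decision. Independence across agents
  enters here.\<close>

lemma integral_decision:
  assumes \<phi>: "\<phi>1 \<in> rules1 M" "\<phi> \<in> rules M"
    and P: "\<And>j. prob_space (P j)" "\<And>j. sets (P j) = sets M"
  shows "(LINT y|PiM {1..Suc n} P. pmf (decision \<phi>1 \<phi> (Suc n) y) True) = traj \<phi>1 \<phi> P n"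
proof -
  interpret product_sigma_finite P
    unfolding product_sigma_finite_def using P(1) by (simp add: prob_space_imp_sigma_finite)
  show ?thesis
  proof (induction n)
    case 0
    have "(LINT y|PiM {1..Suc 0} P. pmf (decision \<phi>1 \<phi> (Suc 0) y) True)
        = (LINT y|PiM {1} P. pmf (\<phi>1 (y 1)) True)"
      by simp
    also have "\<dots> = (LINT y|P 1. pmf (\<phi>1 y) True)"
      using \<phi>(1) P(2)[of 1] by (intro product_integral_singleton)
        (auto simp: rules1_def cong: measurable_cong_sets)
    finally show ?case by simp
  next
    case (Suc n)
    let ?k = "Suc (Suc n)" and ?I = "{1..Suc n}"
    let ?d = "\<lambda>y. pmf (decision \<phi>1 \<phi> (Suc n) y) True"
    let ?f = "\<lambda>u y. pmf (\<phi> y u) True"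
    have I: "{1..?k} = insert ?k ?I" by auto
    interpret I: prob_space "PiM ?I P" by (rule prob_space_PiM) (use P in auto)
    interpret I': prob_space "PiM (insert ?k ?I) P" by (rule prob_space_PiM) (use P in auto)
    interpret k: prob_space "P ?k" using P by auto
    have f_meas: "?f u \<in> borel_measurable (P ?k)" for u
      using \<phi>(2) P(2)[of ?k] by (auto simp: rules_def cong: measurable_cong_sets)
    have f_int: "integrable (P ?k) (?f u)" for u
      by (intro k.integrable_const_bound[of _ 1] f_meas) (auto simp: pmf_le_1)
    have d_int: "integrable (PiM ?I P) ?d"
      by (intro I.integrable_const_bound[of _ 1] decision_measurable[OF \<phi>])
        (auto simp: pmf_le_1 P)
    have "(LINT y|PiM (insert ?k ?I) P. pmf (decision \<phi>1 \<phi> ?k y) True) =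
      (LINT x|PiM ?I P. LINT z|P ?k. pmf (decision \<phi>1 \<phi> ?k (x(?k := z))) True)"
      using P by (intro product_integral_insert I'.integrable_const_bound[of _ 1]
        decision_measurable[OF \<phi>]) (auto simp: pmf_le_1)
    also have "\<dots> = (LINT x|PiM ?I P. LINT z|P ?k. (1 - ?d x) * ?f False z + ?d x * ?f True z)"
      by (simp add: pmf_bind_bool decision_fun_upd pmf_False_conv_True)
    also have "\<dots> = (LINT x|PiM ?I P. (1 - ?d x) * (LINT z|P ?k. ?f False z)
        + ?d x * (LINT z|P ?k. ?f True z))"
      using f_int by (intro Bochner_Integration.integral_cong refl) simp
    also have "\<dots> = traj \<phi>1 \<phi> P (Suc n)"
      using d_int Suc
      by (simp add: I.prob_space Bochner_Integration.integral_add Bochner_Integration.integral_diff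
        del: decision.simps One_nat_def)
    finally show ?case unfolding I .
  qed
qed

lemma error_prob_traj:
  assumes \<phi>: "\<phi>1 \<in> rules1 M" "\<phi> \<in> rules M"
    and P: "\<And>j. prob_space (P j)" "\<And>j. sets (P j) = sets M"
    and P': "\<And>j. prob_space (P' j)" "\<And>j. sets (P' j) = sets M"
  shows "error_prob \<pi>0 \<pi>1 \<phi>1 \<phi> (Suc n) (PiM {1..Suc n} P) (PiM {1..Suc n} P') =
    \<pi>0 * traj \<phi>1 \<phi> P n + \<pi>1 * (1 - traj \<phi>1 \<phi> P' n)"
proof -
  interpret I: prob_space "PiM {1..Suc n} P'" by (rule prob_space_PiM) (use P' in auto)
  have "integrable (PiM {1..Suc n} P') (\<lambda>y. pmf (decision \<phi>1 \<phi> (Suc n) y) True)"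
    by (intro I.integrable_const_bound[of _ 1] decision_measurable[OF \<phi>])
        (auto simp: pmf_le_1 P')
  hence "(LINT y|PiM {1..Suc n} P'. pmf (decision \<phi>1 \<phi> (Suc n) y) False) = 1 - traj \<phi>1 \<phi> P' n"
    using integral_decision[OF \<phi> P', of n]
    by (simp add: pmf_False_conv_True I.prob_space Bochner_Integration.integral_diff
      del: decision.simps One_nat_def)
  thus ?thesis
    unfolding error_prob_def integral_decision[OF \<phi> P] by simp
qed

lemma traj_cong:
  "(\<And>j. 1 \<le> j \<Longrightarrow> j \<le> Suc n \<Longrightarrow> P j = P' j) \<Longrightarrow> traj \<phi>1 \<phi> P n = traj \<phi>1 \<phi> P' n"
  by (induction n) auto

text \<open>Agent \<open>n + 2\<close> is compared with an agent \<open>n + 1\<close> whose predecessors skip the second law of \<open>P\<close>;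
  the two trajectories then pass through the same \<open>n\<close> affine contractions.\<close>

lemma traj_shift_diff:
  fixes P :: "nat \<Rightarrow> 'a measure"
  assumes "\<And>j. prob_space (P j)"
    and "\<And>j. \<bar>(LINT y|P j. pmf (\<phi> y True) True) - (LINT y|P j. pmf (\<phi> y False) True)\<bar> \<le> L"
  shows "\<bar>traj \<phi>1 \<phi> P (Suc n) - traj \<phi>1 \<phi> (\<lambda>j. if j \<le> 1 then P j else P (Suc j)) n\<bar> \<le> L ^ n"
    (is "\<bar>traj _ _ _ (Suc n) - traj _ _ ?S n\<bar> \<le> _")
proof (induction n)
  case 0
  have "traj \<phi>1 \<phi> P (Suc 0) \<in> {0..1}" "traj \<phi>1 \<phi> ?S 0 \<in> {0..1}"
    by (rule traj_unit; simp add: assms(1))+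
  thus ?case by (auto simp del: traj.simps)
next
  case (Suc n)
  let ?j = "Suc (Suc (Suc n))"
  let ?m = "\<lambda>u. LINT y|P ?j. pmf (\<phi> y u) True"
  have "traj \<phi>1 \<phi> P (Suc (Suc n)) - traj \<phi>1 \<phi> ?S (Suc n) =
      (1 - traj \<phi>1 \<phi> P (Suc n)) * ?m False + traj \<phi>1 \<phi> P (Suc n) * ?m True -
      ((1 - traj \<phi>1 \<phi> ?S n) * ?m False + traj \<phi>1 \<phi> ?S n * ?m True)"
    by (subst (1 3) traj.simps(2)) simp
  also have "\<dots> = (?m True - ?m False) * (traj \<phi>1 \<phi> P (Suc n) - traj \<phi>1 \<phi> ?S n)"
    by (simp only: ring_distribs) simp
  finally have "\<bar>traj \<phi>1 \<phi> P (Suc (Suc n)) - traj \<phi>1 \<phi> ?S (Suc n)\<bar> =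
      \<bar>?m True - ?m False\<bar> * \<bar>traj \<phi>1 \<phi> P (Suc n) - traj \<phi>1 \<phi> ?S n\<bar>"
    by (simp only: abs_mult)
  also have "\<dots> \<le> L * L ^ n"
    using assms(2)[of ?j] by (intro mult_mono Suc) auto
  finally show ?case by simp
qed

section \<open>Worst-case errors as suprema over families of laws\<close>

lemma PiM_in_product_class:
  assumes "\<And>j. j \<in> {1..k} \<Longrightarrow> P j \<in> C"
  shows "PiM {1..k} P \<in> product_class C k"
  unfolding product_class_def mem_Collect_eq by (rule exI[of _ P]) (use assms in auto)

lemma error_prob_le_P_DD:
  assumes \<phi>: "\<phi>1 \<in> rules1 M" "\<phi> \<in> rules M"
    and C: "\<And>P. P \<in> C0 \<union> C1 \<Longrightarrow> prob_space P \<and> sets P = sets M"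
    and P: "\<And>j. P j \<in> C0" "\<And>j. P' j \<in> C1" and \<pi>: "0 \<le> \<pi>0" "0 \<le> \<pi>1"
  shows "\<pi>0 * traj \<phi>1 \<phi> P n + \<pi>1 * (1 - traj \<phi>1 \<phi> P' n) \<le> P_DD \<pi>0 \<pi>1 C0 C1 \<phi>1 \<phi> (Suc n)"
proof -
  have err: "error_prob \<pi>0 \<pi>1 \<phi>1 \<phi> (Suc n) R S \<le> \<pi>0 + \<pi>1"
    if RS: "R \<in> product_class C0 (Suc n)" "S \<in> product_class C1 (Suc n)" for R S
  proof -
    have "prob_space R" "prob_space S"
      using RS C unfolding product_class_def by (auto intro!: prob_space_PiM)
    hence "(LINT y|R. pmf (decision \<phi>1 \<phi> (Suc n) y) True) \<in> {0..1}"
      "(LINT y|S. pmf (decision \<phi>1 \<phi> (Suc n) y) False) \<in> {0..1}"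
      by (simp_all only: prob_space.integral_pmf_unit)
    hence "\<pi>0 * (LINT y|R. pmf (decision \<phi>1 \<phi> (Suc n) y) True) +
      \<pi>1 * (LINT y|S. pmf (decision \<phi>1 \<phi> (Suc n) y) False) \<le> \<pi>0 * 1 + \<pi>1 * 1"
      using \<pi> by (intro add_mono mult_left_mono) auto
    thus ?thesis unfolding error_prob_def by simp
  qed
  have "error_prob \<pi>0 \<pi>1 \<phi>1 \<phi> (Suc n) (PiM {1..Suc n} P) (PiM {1..Suc n} P')
    \<le> P_DD \<pi>0 \<pi>1 C0 C1 \<phi>1 \<phi> (Suc n)"
    unfolding P_DD_def
  proof (rule cSUP_upper2[where x = "(PiM {1..Suc n} P, PiM {1..Suc n} P')"])
    show "bdd_above ((\<lambda>(R, S). error_prob \<pi>0 \<pi>1 \<phi>1 \<phi> (Suc n) R S) `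
      (product_class C0 (Suc n) \<times> product_class C1 (Suc n)))"
      by (rule bdd_aboveI[where M = "\<pi>0 + \<pi>1"]) (auto dest: err)
    show "(PiM {1..Suc n} P, PiM {1..Suc n} P') \<in> product_class C0 (Suc n) \<times> product_class C1 (Suc n)"
      by (intro SigmaI PiM_in_product_class P)
  qed simp
  moreover have "error_prob \<pi>0 \<pi>1 \<phi>1 \<phi> (Suc n) (PiM {1..Suc n} P) (PiM {1..Suc n} P') =
    \<pi>0 * traj \<phi>1 \<phi> P n + \<pi>1 * (1 - traj \<phi>1 \<phi> P' n)"
    using C P by (intro error_prob_traj[OF \<phi>]) auto
  ultimately show ?thesis by simp
qed

lemma P_DD_le:
  assumes \<phi>: "\<phi>1 \<in> rules1 M" "\<phi> \<in> rules M"
    and C: "\<And>P. P \<in> C0 \<union> C1 \<Longrightarrow> prob_space P \<and> sets P = sets M"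
    and ne: "C0 \<noteq> {}" "C1 \<noteq> {}"
    and le: "\<And>P P'. (\<And>j. P j \<in> C0) \<Longrightarrow> (\<And>j. P' j \<in> C1) \<Longrightarrow>
      \<pi>0 * traj \<phi>1 \<phi> P n + \<pi>1 * (1 - traj \<phi>1 \<phi> P' n) \<le> c"
  shows "P_DD \<pi>0 \<pi>1 C0 C1 \<phi>1 \<phi> (Suc n) \<le> c"
  unfolding P_DD_def
proof (rule cSUP_least)
  obtain R S where "R \<in> C0" "S \<in> C1" using ne by blast
  hence "PiM {1..Suc n} (\<lambda>_. R) \<in> product_class C0 (Suc n)"
    "PiM {1..Suc n} (\<lambda>_. S) \<in> product_class C1 (Suc n)"
    by (simp_all only: PiM_in_product_class)
  thus "product_class C0 (Suc n) \<times> product_class C1 (Suc n) \<noteq> {}"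
    by blast
  fix z assume "z \<in> product_class C0 (Suc n) \<times> product_class C1 (Suc n)"
  then obtain P P' where z: "z = (PiM {1..Suc n} P, PiM {1..Suc n} P')"
    and P: "\<And>j. j \<in> {1..Suc n} \<Longrightarrow> P j \<in> C0" and P': "\<And>j. j \<in> {1..Suc n} \<Longrightarrow> P' j \<in> C1"
    by (auto simp: product_class_def simp del: One_nat_def)
  \<comment> \<open>A product law says nothing about its factors outside \<open>{1..Suc n}\<close>;
    these are filled with fixed members of the classes, so that \<open>le\<close> applies.\<close>
  define T where "T j = (if j \<in> {1..Suc n} then P j else R)" for j
  define T' where "T' j = (if j \<in> {1..Suc n} then P' j else S)" for j
  have T: "T j \<in> C0" "T' j \<in> C1" for j
    using P P' \<open>R \<in> C0\<close> \<open>S \<in> C1\<close> by (auto simp: T_def T'_def)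
  have "z = (PiM {1..Suc n} T, PiM {1..Suc n} T')"
    unfolding z by (auto simp: T_def T'_def intro!: PiM_cong)
  moreover have "error_prob \<pi>0 \<pi>1 \<phi>1 \<phi> (Suc n) (PiM {1..Suc n} T) (PiM {1..Suc n} T') =
    \<pi>0 * traj \<phi>1 \<phi> T n + \<pi>1 * (1 - traj \<phi>1 \<phi> T' n)"
    using C T by (intro error_prob_traj[OF \<phi>]) auto
  ultimately show "(case z of (R, S) \<Rightarrow> error_prob \<pi>0 \<pi>1 \<phi>1 \<phi> (Suc n) R S) \<le> c"
    using le[OF T] by simp
qed

section \<open>Likelihood ratio tests\<close>

text \<open>The infimum of the points where the distribution function has reached \<open>a\<close>
  works: its left limit there is at most \<open>a\<close>, and right continuity gives the other
  bound. A possible atom at \<open>t\<close> is what a test of exact level randomizes on.\<close>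

lemma (in real_distribution) quantile_exists:
  assumes "0 < a" "a < 1"
  obtains t where "measure M {..<t} \<le> a" "a \<le> cdf M t"
proof -
  define S where "S = {t. a \<le> cdf M t}"
  obtain b where b: "\<And>s. s \<le> b \<Longrightarrow> cdf M s < a"
    using order_tendstoD(2)[OF cdf_lim_at_bot assms(1)] unfolding eventually_at_bot_linorder by auto
  obtain c where c: "\<And>s. s \<ge> c \<Longrightarrow> a < cdf M s"
    using order_tendstoD(1)[OF cdf_lim_at_top_prob assms(2)] unfolding eventually_at_top_linorder by auto
  have ne: "S \<noteq> {}" using c[of c] by (auto simp: S_def intro: exI[of _ c])
  have bdd: "bdd_below S"
    using b by (intro bdd_belowI[of _ b]) (metis S_def linorder_linear mem_Collect_eq not_less)
  have above: "a \<le> cdf M s" if s: "Inf S < s" for s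
  proof -
    obtain u where "u \<in> S" "u < s" using s ne bdd by (meson cInf_less_iff)
    thus ?thesis using cdf_nondecreasing[of u s] by (auto simp: S_def)
  qed
  have below: "cdf M s \<le> a" if "s < Inf S" for s
    using that cInf_lower[OF _ bdd, of s] by (fastforce simp: S_def)
  show thesis
  proof (rule that)
    show "measure M {..<Inf S} \<le> a"
      using below by (intro tendsto_upperbound[OF cdf_at_left]) (auto simp: eventually_at_left_field intro: lt_ex)
    show "a \<le> cdf M (Inf S)"
      using cdf_is_right_cont[of "Inf S"] above unfolding continuous_within
      by (intro tendsto_lowerbound) (auto simp: eventually_at_right_field intro: gt_ex)
  qed
qed

locale test_pair =
  fixes \<mu> :: "'a measure" and q0 q1 :: "'a \<Rightarrow> real"
  assumes q_meas [measurable]: "q0 \<in> borel_measurable \<mu>" "q1 \<in> borel_measurable \<mu>"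
    and q_pos: "\<And>y. y \<in> space \<mu> \<Longrightarrow> 0 < q0 y" "\<And>y. y \<in> space \<mu> \<Longrightarrow> 0 < q1 y"
    and q_prob: "prob_space (density \<mu> q0)" "prob_space (density \<mu> q1)"
begin

definition tests :: "('a \<Rightarrow> real) set" where
  "tests = {f \<in> borel_measurable \<mu>. \<forall>y. f y \<in> {0..1}}"

definition E0 :: "('a \<Rightarrow> real) \<Rightarrow> real" where
  "E0 f = (LINT y|density \<mu> q0. f y)"

definition E1 :: "('a \<Rightarrow> real) \<Rightarrow> real" where
  "E1 f = (LINT y|density \<mu> q1. f y)"

text \<open>Extended thresholds make the constant tests 0 and 1 instances; the copying rule is built
  from these two.\<close>

definition thr :: "ereal \<Rightarrow> real \<Rightarrow> 'a \<Rightarrow> real" where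
  "thr t r y = (if t < ereal (q1 y / q0 y) then 1 else if ereal (q1 y / q0 y) = t then r else 0)"

lemma thr_tests: "r \<in> {0..1} \<Longrightarrow> thr t r \<in> tests"
  unfolding tests_def thr_def by auto

lemma pmf_tests: "(\<lambda>y. pmf (f y) True) \<in> borel_measurable \<mu> \<Longrightarrow> (\<lambda>y. pmf (f y) True) \<in> tests"
  by (auto simp: tests_def pmf_le_1)

lemma AE_q_nonneg: "AE y in \<mu>. 0 \<le> q0 y" "AE y in \<mu>. 0 \<le> q1 y"
  using q_pos by (auto intro!: AE_I2 less_imp_le)

lemma integrable_bounded:
  fixes f :: "'a \<Rightarrow> real"
  assumes "f \<in> borel_measurable \<mu>" "\<And>y. \<bar>f y\<bar> \<le> 1"
  shows "integrable (density \<mu> q0) f" "integrable (density \<mu> q1) f"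
    "integrable \<mu> (\<lambda>y. q0 y * f y)" "integrable \<mu> (\<lambda>y. q1 y * f y)"
proof -
  interpret Q0: prob_space "density \<mu> q0" by (rule q_prob)
  interpret Q1: prob_space "density \<mu> q1" by (rule q_prob)
  show *: "integrable (density \<mu> q0) f" "integrable (density \<mu> q1) f"
    using assms by (auto intro!: Q0.integrable_const_bound[of _ 1] Q1.integrable_const_bound[of _ 1])
  show "integrable \<mu> (\<lambda>y. q0 y * f y)" "integrable \<mu> (\<lambda>y. q1 y * f y)"
    using * assms(1) AE_q_nonneg by (simp_all add: integrable_density)
qed

lemma
  assumes "f \<in> tests"
  shows tests_integrable: "integrable (density \<mu> q0) f" "integrable (density \<mu> q1) f"
      "integrable \<mu> (\<lambda>y. q0 y * f y)" "integrable \<mu> (\<lambda>y. q1 y * f y)"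
    and E0_eq: "E0 f = (LINT y|\<mu>. q0 y * f y)"
    and E1_eq: "E1 f = (LINT y|\<mu>. q1 y * f y)"
    and E0_unit: "E0 f \<in> {0..1}" and E1_unit: "E1 f \<in> {0..1}"
proof -
  interpret Q0: prob_space "density \<mu> q0" by (rule q_prob)
  interpret Q1: prob_space "density \<mu> q1" by (rule q_prob)
  have f: "f \<in> borel_measurable \<mu>" "0 \<le> f y" "f y \<le> 1" for y using assms by (auto simp: tests_def)
  show i: "integrable (density \<mu> q0) f" "integrable (density \<mu> q1) f"
      "integrable \<mu> (\<lambda>y. q0 y * f y)" "integrable \<mu> (\<lambda>y. q1 y * f y)"
    using f by (auto intro!: integrable_bounded simp: abs_le_iff order_trans[OF _ f(2)])
  show "E0 f = (LINT y|\<mu>. q0 y * f y)" "E1 f = (LINT y|\<mu>. q1 y * f y)"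
    using f AE_q_nonneg by (simp_all add: E0_def E1_def integral_density)
  show "E0 f \<in> {0..1}" "E1 f \<in> {0..1}"
    using f i by (auto simp: E0_def E1_def intro!: Q0.integral_le_const Q1.integral_le_const)
qed

lemma
  assumes "f \<in> tests" "g \<in> tests" "\<And>y. y \<in> space \<mu> \<Longrightarrow> f y \<le> g y"
  shows E0_mono: "E0 f \<le> E0 g" and E1_mono: "E1 f \<le> E1 g"
  unfolding E0_def E1_def using assms tests_integrable
  by (auto intro!: integral_mono)

lemma
  assumes "f \<in> tests" "g \<in> tests" "c \<in> {0..1}"
  shows tests_convex: "(\<lambda>y. (1 - c) * f y + c * g y) \<in> tests"
    and E0_convex: "E0 (\<lambda>y. (1 - c) * f y + c * g y) = (1 - c) * E0 f + c * E0 g"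
    and E1_convex: "E1 (\<lambda>y. (1 - c) * f y + c * g y) = (1 - c) * E1 f + c * E1 g"
proof -
  show "(\<lambda>y. (1 - c) * f y + c * g y) \<in> tests"
    using assms convex_unit[OF _ _ assms(3)] unfolding tests_def by auto
  show "E0 (\<lambda>y. (1 - c) * f y + c * g y) = (1 - c) * E0 f + c * E0 g"
    "E1 (\<lambda>y. (1 - c) * f y + c * g y) = (1 - c) * E1 f + c * E1 g"
    using tests_integrable assms by (simp_all add: E0_def E1_def)
qed

lemma const_tests:
  assumes "c \<in> {0..1}"
  shows "(\<lambda>_. c) \<in> tests" "E0 (\<lambda>_. c) = c" "E1 (\<lambda>_. c) = c"
proof -
  interpret Q0: prob_space "density \<mu> q0" by (rule q_prob)
  interpret Q1: prob_space "density \<mu> q1" by (rule q_prob)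
  show "(\<lambda>_. c) \<in> tests" "E0 (\<lambda>_. c) = c" "E1 (\<lambda>_. c) = c"
    using assms by (auto simp: tests_def E0_def E1_def Q0.prob_space[simplified] Q1.prob_space[simplified])
qed

text \<open>The threshold test maximizes \<open>(q1 - t * q0) * f\<close> pointwise. Geometrically,
  the line of slope \<open>t\<close> through its ROC point supports the ROC region. This form
  handles sizes on both sides of that point, and limits.\<close>

lemma neyman_pearson:
  assumes f: "f \<in> tests" and r: "r \<in> {0..1}"
  shows "E1 f - E1 (thr (ereal t) r) \<le> t * (E0 f - E0 (thr (ereal t) r))"
proof -
  note g = thr_tests[OF r, of "ereal t"]
  have "(LINT y|\<mu>. q1 y * f y - t * (q0 y * f y))
      \<le> (LINT y|\<mu>. q1 y * thr (ereal t) r y - t * (q0 y * thr (ereal t) r y))"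
  proof (rule integral_mono)
    fix y assume y: "y \<in> space \<mu>"
    have fy: "0 \<le> f y" "f y \<le> 1" using f by (auto simp: tests_def)
    have "(q1 y - t * q0 y) * f y \<le> (q1 y - t * q0 y) * thr (ereal t) r y"
    proof (cases "ereal t" "ereal (q1 y / q0 y)" rule: linorder_cases)
      case less
      hence "0 \<le> q1 y - t * q0 y" using q_pos(1)[OF y] by (simp add: field_simps)
      from mult_left_mono[OF fy(2) this] show ?thesis using less by (simp add: thr_def)
    next
      case equal
      hence "q1 y - t * q0 y = 0" using q_pos(1)[OF y] by (simp add: field_simps)
      thus ?thesis by simp
    next
      case greater
      hence "q1 y - t * q0 y \<le> 0" using q_pos(1)[OF y] by (simp add: field_simps)
      from mult_nonpos_nonneg[OF this fy(1)] show ?thesis using greater by (simp add: thr_def)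
    qed
    thus "q1 y * f y - t * (q0 y * f y) \<le> q1 y * thr (ereal t) r y - t * (q0 y * thr (ereal t) r y)"
      by (simp add: algebra_simps)
  qed (use tests_integrable[OF f] tests_integrable[OF g] in auto)
  thus ?thesis
    using tests_integrable[OF f] tests_integrable[OF g]
    by (simp add: E0_eq E1_eq f g algebra_simps)
qed

section \<open>Most powerful tests of every level\<close>

lemma thr_infty:
  shows "thr \<infinity> r = (\<lambda>_. 0)" "thr (-\<infinity>) r = (\<lambda>_. 1)"
  by (auto simp: thr_def fun_eq_iff)

lemma thr_antimono:
  assumes "s < t" "r \<in> {0..1}" "r' \<in> {0..1}"
  shows "thr t r y \<le> thr s r' y"
  using assms by (auto simp: thr_def)

lemma E1_thr_tendsto: "(\<lambda>n. E1 (thr (ereal (real n)) 0)) \<longlonglongrightarrow> 0"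
proof -
  have "(\<lambda>n. LINT y|\<mu>. q1 y * thr (ereal (real n)) 0 y) \<longlonglongrightarrow> (LINT y|\<mu>. 0)"
  proof (rule integral_dominated_convergence)
    show "integrable \<mu> q1" using tests_integrable(4)[OF const_tests(1)[of 1]] by simp
    show "AE y in \<mu>. (\<lambda>n. q1 y * thr (ereal (real n)) 0 y) \<longlonglongrightarrow> 0"
    proof (intro AE_I2 tendsto_eventually)
      fix y
      obtain N where "q1 y / q0 y < real N" using reals_Archimedean2 by blast
      thus "\<forall>\<^sub>F n in sequentially. q1 y * thr (ereal (real n)) 0 y = 0"
        unfolding eventually_sequentially by (intro exI[of _ N]) (auto simp: thr_def)
    qed
    show "AE y in \<mu>. norm (q1 y * thr (ereal (real n)) 0 y) \<le> q1 y" for n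
      using q_pos by (intro AE_I2) (auto simp: thr_def less_imp_le)
  qed (use thr_tests[of 0] in \<open>auto simp: tests_def intro!: borel_measurable_times\<close>)
  thus ?thesis using E1_eq[OF thr_tests[of 0]] by simp
qed

text \<open>The last conjunct, upper semicontinuity of the ROC curve at \<open>a\<close>, makes the compactness argument
  for the existence of a minimizer work.\<close>

definition most_powerful :: "real \<Rightarrow> ereal \<Rightarrow> real \<Rightarrow> bool" where
  "most_powerful a t r \<longleftrightarrow> r \<in> {0..1} \<and> E0 (thr t r) = a \<and>
     (\<forall>f\<in>tests. E0 f \<le> a \<longrightarrow> E1 f \<le> E1 (thr t r)) \<and>
     (\<forall>f d. (\<forall>n. f n \<in> tests) \<longrightarrow> (\<lambda>n. E0 (f n)) \<longlonglongrightarrow> a \<longrightarrow> (\<lambda>n. E1 (f n)) \<longlonglongrightarrow> d \<longrightarrow>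
        d \<le> E1 (thr t r))"

text \<open>For a nonnegative slope the supporting line bounds the power at all smaller sizes, and a
  linear bound survives limits.\<close>

lemma most_powerful_thr:
  assumes "r \<in> {0..1}" "0 \<le> t"
  shows "most_powerful (E0 (thr (ereal t) r)) (ereal t) r"
  unfolding most_powerful_def
proof (intro conjI ballI allI impI)
  fix f assume f: "f \<in> tests" "E0 f \<le> E0 (thr (ereal t) r)"
  have "t * (E0 f - E0 (thr (ereal t) r)) \<le> 0"
    using f assms by (intro mult_nonneg_nonpos) auto
  thus "E1 f \<le> E1 (thr (ereal t) r)" using neyman_pearson[OF f(1) assms(1), of t] by linarith
next
  fix f d
  assume f: "\<forall>n. f n \<in> tests" "(\<lambda>n. E0 (f n)) \<longlonglongrightarrow> E0 (thr (ereal t) r)" "(\<lambda>n. E1 (f n)) \<longlonglongrightarrow> d"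
  have "d \<le> E1 (thr (ereal t) r) + t * (E0 (thr (ereal t) r) - E0 (thr (ereal t) r))"
  proof (rule LIMSEQ_le[OF f(3)])
    show "(\<lambda>n. E1 (thr (ereal t) r) + t * (E0 (f n) - E0 (thr (ereal t) r)))
        \<longlonglongrightarrow> E1 (thr (ereal t) r) + t * (E0 (thr (ereal t) r) - E0 (thr (ereal t) r))"
      by (intro tendsto_intros f)
    show "\<exists>N. \<forall>n\<ge>N. E1 (f n) \<le> E1 (thr (ereal t) r) + t * (E0 (f n) - E0 (thr (ereal t) r))"
      using neyman_pearson[OF f(1)[rule_format] assms(1), of _ t] by (auto simp: algebra_simps)
  qed
  thus "d \<le> E1 (thr (ereal t) r)" by simp
qed (use assms in auto)

text \<open>The ROC curve may be arbitrarily steep at the origin, so no single line suffices. The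
  line of slope \<open>k\<close> bounds the limiting power by that of the test with threshold
  \<open>k\<close>, which vanishes as \<open>k\<close> grows because the likelihood ratio is
  finite.\<close>

lemma most_powerful_zero: "most_powerful 0 \<infinity> 0"
proof -
  have lim: "d \<le> 0"
    if f: "\<And>n. f n \<in> tests" "(\<lambda>n. E0 (f n)) \<longlonglongrightarrow> 0" "(\<lambda>n. E1 (f n)) \<longlonglongrightarrow> d" for f d
  proof (rule LIMSEQ_le_const[OF E1_thr_tendsto], intro exI allI impI)
    fix k :: nat
    show "d \<le> E1 (thr (ereal (real k)) 0)"
    proof (rule LIMSEQ_le[OF f(3)])
      show "(\<lambda>n. E1 (thr (ereal (real k)) 0) + real k * E0 (f n)) \<longlonglongrightarrow> E1 (thr (ereal (real k)) 0)"
        using tendsto_add[OF tendsto_const tendsto_mult_right_zero[OF f(2)]] by simp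
      have "E1 (f n) \<le> E1 (thr (ereal (real k)) 0) + real k * E0 (f n)" for n
      proof -
        have "0 \<le> real k * E0 (thr (ereal (real k)) 0)"
          using E0_unit[OF thr_tests[of 0]] by auto
        thus ?thesis
          using neyman_pearson[OF f(1)[of n], of 0 "real k"] by (simp add: algebra_simps)
      qed
      thus "\<exists>N. \<forall>n\<ge>N. E1 (f n) \<le> E1 (thr (ereal (real k)) 0) + real k * E0 (f n)" by blast
    qed
  qed
  have "E1 f \<le> 0" if "f \<in> tests" "E0 f \<le> 0" for f
    using lim[of "\<lambda>_. f" "E1 f"] that E0_unit[OF that(1)] by auto
  thus ?thesis
    using lim const_tests[of 0] unfolding most_powerful_def thr_infty by auto
qed

lemma most_powerful_exists:
  assumes "a \<in> {0..1}"
  shows "\<exists>t r. most_powerful a t r"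
proof -
  consider "a = 0" | "a = 1" | "0 < a" "a < 1" using assms by fastforce
  thus ?thesis
  proof cases
    case 1
    thus ?thesis using most_powerful_zero by auto
  next
    case 2
    \<comment> \<open>The ratio is positive on the space, so threshold 0 always decides 1; being
      real, it falls under \<open>most_powerful_thr\<close>, unlike
      \<open>-\<infinity>\<close>.\<close>
    have "E0 (thr (ereal 0) 0) = E0 (\<lambda>_. 1)"
      unfolding E0_def using q_pos
      by (intro Bochner_Integration.integral_cong) (auto simp: thr_def)
    thus ?thesis using most_powerful_thr[of 0 0] const_tests[of 1] 2 by auto
  next
    case 3
    let ?l = "\<lambda>y. q1 y / q0 y" and ?Q = "density \<mu> q0"
    interpret Q: prob_space ?Q by (rule q_prob)
    interpret D: real_distribution "distr ?Q borel ?l"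
      by (intro Q.real_distribution_distr) auto
    obtain t where t: "measure (distr ?Q borel ?l) {..<t} \<le> 1 - a" "1 - a \<le> cdf (distr ?Q borel ?l) t"
      using D.quantile_exists[of "1 - a"] 3 by auto
    define L where "L = measure ?Q {y \<in> space \<mu>. ?l y < t}"
    define G where "G = measure ?Q {y \<in> space \<mu>. t < ?l y}"
    define M where "M = measure ?Q {y \<in> space \<mu>. ?l y = t}"
    have L: "L \<le> 1 - a"
      using t(1) unfolding L_def by (simp add: measure_distr vimage_def Int_def conj_commute)
    have LM: "1 - a \<le> measure ?Q {y \<in> space \<mu>. ?l y \<le> t}"
      using t(2) unfolding cdf_def by (simp add: measure_distr vimage_def Int_def conj_commute)
    have "{y \<in> space \<mu>. ?l y \<le> t} = {y \<in> space \<mu>. ?l y < t} \<union> {y \<in> space \<mu>. ?l y = t}" by auto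
    hence LM': "measure ?Q {y \<in> space \<mu>. ?l y \<le> t} = L + M"
      unfolding L_def M_def by (simp add: Q.finite_measure_Union disjoint_iff)
    have "measure ?Q (space \<mu> - {y \<in> space \<mu>. ?l y \<le> t}) = 1 - measure ?Q {y \<in> space \<mu>. ?l y \<le> t}"
      using Q.prob_compl[of "{y \<in> space \<mu>. ?l y \<le> t}"] by simp
    moreover have "space \<mu> - {y \<in> space \<mu>. ?l y \<le> t} = {y \<in> space \<mu>. t < ?l y}" by auto
    ultimately have G: "G = 1 - (L + M)" unfolding G_def LM' by simp
    have level: "E0 (thr (ereal t) r) = G + r * M" for r
    proof -
      have "E0 (thr (ereal t) r) =
          (LINT y|?Q. indicator {y \<in> space \<mu>. t < ?l y} y + r * indicator {y \<in> space \<mu>. ?l y = t} y)"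
        unfolding E0_def by (intro Bochner_Integration.integral_cong) (auto simp: thr_def indicator_def)
      also have "\<dots> = G + r * M"
        unfolding G_def M_def
        by (subst Bochner_Integration.integral_add) (auto simp: Q.emeasure_eq_measure)
      finally show ?thesis .
    qed
    have M0: "0 \<le> M" by (simp add: M_def)
    \<comment> \<open>\<open>r\<close> solves \<open>G + r * M = a\<close>. If the atom at
      \<open>t\<close> is null, then \<open>G = a\<close> already and any value would do.\<close>
    define r where "r = (if M = 0 then 0 else (a - G) / M)"
    have r: "r \<in> {0..1}" "G + r * M = a"
      using L LM LM' G M0 by (auto simp: r_def field_simps)
    have "0 \<le> t"
    proof (rule ccontr)
      assume "\<not> 0 \<le> t"
      hence "{y \<in> space \<mu>. ?l y \<le> t} = {}"
        using q_pos by (force simp: not_le dest: divide_pos_pos)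
      thus False using LM 3 by (simp only: measure_empty)
    qed
    thus ?thesis using most_powerful_thr[OF r(1)] level r(2) by metis
  qed
qed

end

section \<open>The robust problem\<close>

text \<open>The classes enter mainly through \<open>thr_dominated\<close>: no law in them is worse
  for a threshold test than the least favorable one. Continuity of the likelihood ratio enters
  through \<open>tie_null\<close>, which says that the value 1 of \<open>q1 / q0\<close> is null
  under Q0.\<close>

locale robust_pair = test_pair \<mu> q0 q1
  for \<mu> :: "'a measure" and q0 q1 +
  fixes C0 C1 :: "'a measure set" and \<pi>0 \<pi>1 :: real and \<phi>1 :: "'a \<Rightarrow> bool pmf"
  assumes prior: "0 < \<pi>0" "0 < \<pi>1" "\<pi>0 + \<pi>1 = 1"
    and class_prob: "\<And>P. P \<in> C0 \<union> C1 \<Longrightarrow> prob_space P \<and> sets P = sets \<mu>"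
    and Q_in_class: "density \<mu> q0 \<in> C0" "density \<mu> q1 \<in> C1"
    and thr_dominated: "\<And>P t r. P \<in> C0 \<Longrightarrow> r \<in> {0..1} \<Longrightarrow> (LINT y|P. thr t r y) \<le> E0 (thr t r)"
      "\<And>P t r. P \<in> C1 \<Longrightarrow> r \<in> {0..1} \<Longrightarrow> E1 (thr t r) \<le> (LINT y|P. thr t r y)"
    and tie_null: "\<And>r r'. E0 (thr 1 r) = E0 (thr 1 r')"
    and agent1: "is_arg_min (P1_SL \<pi>0 \<pi>1 C0 C1) (\<lambda>\<psi>. \<psi> \<in> rules1 \<mu>) \<phi>1"
begin

abbreviation "DD \<equiv> P_DD \<pi>0 \<pi>1 C0 C1 \<phi>1"
abbreviation "Pmax \<equiv> Pmax_SL \<pi>0 \<pi>1 C0 C1 \<phi>1"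

text \<open>\<open>A \<phi> u\<close> and \<open>D \<phi> u\<close> are the probabilities under \<open>Q0\<close> and \<open>Q1\<close> of deciding 1 when the previous
  decision is \<open>u\<close>; \<open>err\<close> at \<open>n\<close> is the resulting error of agent \<open>n + 1\<close>.\<close>

definition "x1 = E0 (\<lambda>y. pmf (\<phi>1 y) True)"
definition "w1 = E1 (\<lambda>y. pmf (\<phi>1 y) True)"
definition "e1 = \<pi>0 * x1 + \<pi>1 * (1 - w1)"

definition "A \<phi> u = E0 (\<lambda>y. pmf (\<phi> y u) True)"
definition "D \<phi> u = E1 (\<lambda>y. pmf (\<phi> y u) True)"

definition err :: "real \<Rightarrow> real \<Rightarrow> real \<Rightarrow> real \<Rightarrow> nat \<Rightarrow> real" where
  "err a b c d n = \<pi>0 * markov a b x1 n + \<pi>1 * (1 - markov c d w1 n)"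

text \<open>A threshold is indexed by the previous decision after which it is used, so trusting that
  decision means \<open>t1 < t0\<close>.\<close>

definition thr_rule :: "ereal \<Rightarrow> real \<Rightarrow> ereal \<Rightarrow> real \<Rightarrow> 'a \<Rightarrow> bool \<Rightarrow> bool pmf" where
  "thr_rule t0 r0 t1 r1 y u = bernoulli_pmf (if u then thr t1 r1 y else thr t0 r0 y)"

lemma phi1_rules: "\<phi>1 \<in> rules1 \<mu>"
  using agent1 by (auto simp: is_arg_min_def)

lemma phi1_tests: "(\<lambda>y. pmf (\<phi>1 y) True) \<in> tests"
  using phi1_rules by (intro pmf_tests) (auto simp: rules1_def)

lemma rule_tests: "\<phi> \<in> rules \<mu> \<Longrightarrow> (\<lambda>y. pmf (\<phi> y u) True) \<in> tests"
  by (intro pmf_tests) (auto simp: rules_def)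

lemma unit: "x1 \<in> {0..1}" "w1 \<in> {0..1}"
  "\<phi> \<in> rules \<mu> \<Longrightarrow> A \<phi> u \<in> {0..1}" "\<phi> \<in> rules \<mu> \<Longrightarrow> D \<phi> u \<in> {0..1}"
  unfolding x1_def w1_def A_def D_def
  by (intro E0_unit E1_unit phi1_tests rule_tests; assumption)+

lemma x1_w1_bounds [simp]: "0 \<le> x1" "x1 \<le> 1" "0 \<le> w1" "w1 \<le> 1"
  using unit(1,2) by auto

lemma err_0: "err a b c d 0 = e1"
  by (simp add: err_def e1_def)

lemma thr_unit: "r \<in> {0..1} \<Longrightarrow> thr t r y \<in> {0..1}"
  by (auto simp: thr_def)

lemma pmf_thr_rule:
  assumes "r0 \<in> {0..1}" "r1 \<in> {0..1}"
  shows "pmf (thr_rule t0 r0 t1 r1 y u) True = (if u then thr t1 r1 y else thr t0 r0 y)"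
  unfolding thr_rule_def using thr_unit[OF assms(1), of t0 y] thr_unit[OF assms(2), of t1 y] by auto

lemma thr_rule_rules:
  assumes "r0 \<in> {0..1}" "r1 \<in> {0..1}"
  shows "thr_rule t0 r0 t1 r1 \<in> rules \<mu>"
  using thr_tests[OF assms(1), of t0] thr_tests[OF assms(2), of t1]
  unfolding rules_def tests_def by (auto simp: pmf_thr_rule[OF assms])

lemma integral_class_unit:
  assumes "P \<in> C0 \<union> C1"
  shows "(LINT y|P. pmf (f y) b) \<in> {0..1}"
  by (rule prob_space.integral_pmf_unit) (use class_prob[OF assms] in simp)

section \<open>The optimal rule of the first agent\<close>

lemma error1_eq:
  assumes "P \<in> C0" "P' \<in> C1" "\<psi> \<in> rules1 \<mu>"
  shows "error1 \<pi>0 \<pi>1 \<psi> P P' =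
    \<pi>0 * (LINT y|P. pmf (\<psi> y) True) + \<pi>1 * (1 - (LINT y|P'. pmf (\<psi> y) True))"
proof -
  interpret P': prob_space P' using class_prob assms by blast
  have "integrable P' (\<lambda>y. pmf (\<psi> y) True)"
    using assms class_prob[of P']
    by (intro P'.integrable_const_bound[of _ 1])
      (auto simp: pmf_le_1 rules1_def cong: measurable_cong_sets)
  thus ?thesis
    unfolding error1_def pmf_False_conv_True by (simp add: P'.prob_space)
qed

lemma error1_le_P1_SL:
  assumes "P \<in> C0" "P' \<in> C1"
  shows "error1 \<pi>0 \<pi>1 \<psi> P P' \<le> P1_SL \<pi>0 \<pi>1 C0 C1 \<psi>"
  unfolding P1_SL_def
proof (rule cSUP_upper2[where x = "(P, P')"])
  show "bdd_above ((\<lambda>(P0, P1). error1 \<pi>0 \<pi>1 \<psi> P0 P1) ` (C0 \<times> C1))"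
  proof (rule bdd_aboveI2[where M = "\<pi>0 * 1 + \<pi>1 * 1"])
    fix z assume "z \<in> C0 \<times> C1"
    then obtain R S where z: "z = (R, S)" "R \<in> C0" "S \<in> C1" by auto
    thus "(case z of (P0, P1) \<Rightarrow> error1 \<pi>0 \<pi>1 \<psi> P0 P1) \<le> \<pi>0 * 1 + \<pi>1 * 1"
      unfolding error1_def z(1) prod.case using prior integral_class_unit[of R \<psi> True] integral_class_unit[of S \<psi> False]
      by (intro add_mono mult_left_mono) auto
  qed
qed (use assms in auto)

text \<open>The Bayes test, with threshold \<open>\<pi>0 / \<pi>1\<close>, is optimal against the
  least favorable pair, and as a threshold test it has its worst case there. An optimal
  \<open>\<phi>1\<close> can do no worse than this saddle value.\<close>

lemma bayes_bound:
  assumes "f \<in> tests"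
  shows "P1_SL \<pi>0 \<pi>1 C0 C1 \<phi>1 \<le> \<pi>0 * E0 f + \<pi>1 * (1 - E1 f)"
proof -
  define g where "g = thr (ereal (\<pi>0 / \<pi>1)) 0"
  have g: "g \<in> tests" unfolding g_def by (rule thr_tests) simp
  define \<psi> where "\<psi> y = bernoulli_pmf (g y)" for y
  have pmf: "pmf (\<psi> y) True = g y" for y
    using g unfolding \<psi>_def tests_def by auto
  have \<psi>: "\<psi> \<in> rules1 \<mu>"
    using g by (auto simp: rules1_def pmf tests_def)
  have "P1_SL \<pi>0 \<pi>1 C0 C1 \<psi> \<le> \<pi>0 * E0 g + \<pi>1 * (1 - E1 g)"
    unfolding P1_SL_def
  proof (rule cSUP_least)
    show "C0 \<times> C1 \<noteq> {}" using Q_in_class by auto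
    fix z assume "z \<in> C0 \<times> C1"
    then obtain P P' where z: "z = (P, P')" "P \<in> C0" "P' \<in> C1" by auto
    have "error1 \<pi>0 \<pi>1 \<psi> P P' \<le> \<pi>0 * E0 g + \<pi>1 * (1 - E1 g)"
      unfolding error1_eq[OF z(2,3) \<psi>] pmf g_def using prior thr_dominated z
      by (intro add_mono mult_left_mono diff_left_mono) auto
    thus "(case z of (P0, P1) \<Rightarrow> error1 \<pi>0 \<pi>1 \<psi> P0 P1) \<le> \<pi>0 * E0 g + \<pi>1 * (1 - E1 g)"
      by (simp add: z)
  qed
  moreover have "P1_SL \<pi>0 \<pi>1 C0 C1 \<phi>1 \<le> P1_SL \<pi>0 \<pi>1 C0 C1 \<psi>"
    using agent1 \<psi> by (force simp: is_arg_min_def not_less)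
  moreover have "\<pi>1 * (E1 f - E1 g) \<le> \<pi>1 * (\<pi>0 / \<pi>1 * (E0 f - E0 g))"
    using neyman_pearson[OF assms, of 0 "\<pi>0 / \<pi>1"] prior unfolding g_def
    by (intro mult_left_mono) auto
  hence "\<pi>1 * E1 f - \<pi>1 * E1 g \<le> \<pi>0 * E0 f - \<pi>0 * E0 g"
    using prior by (simp add: algebra_simps)
  ultimately show ?thesis by (simp add: algebra_simps)
qed

lemma P1_SL_phi1: "P1_SL \<pi>0 \<pi>1 C0 C1 \<phi>1 = e1"
proof (rule antisym)
  show "P1_SL \<pi>0 \<pi>1 C0 C1 \<phi>1 \<le> e1"
    using bayes_bound[OF phi1_tests] by (simp add: e1_def x1_def w1_def)
  show "e1 \<le> P1_SL \<pi>0 \<pi>1 C0 C1 \<phi>1"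
    using error1_le_P1_SL[OF Q_in_class, of \<phi>1] error1_eq[OF Q_in_class phi1_rules]
    by (simp add: e1_def x1_def w1_def E0_def E1_def)
qed

lemma e1_le_test: "f \<in> tests \<Longrightarrow> e1 \<le> \<pi>0 * E0 f + \<pi>1 * (1 - E1 f)"
  using bayes_bound P1_SL_phi1 by simp

lemma e1_le_prior: "e1 \<le> \<pi>0" "e1 \<le> \<pi>1"
  using e1_le_test[of "\<lambda>_. 1"] e1_le_test[of "\<lambda>_. 0"] const_tests[of 0] const_tests[of 1] by auto

text \<open>Otherwise \<open>\<phi>1\<close> would lose to deciding for the more probable hypothesis
  without looking at the data.\<close>

lemma x1_le_w1: "x1 \<le> w1"
proof (rule ccontr)
  assume less: "\<not> x1 \<le> w1"
  have *: "\<pi>0 * x1 \<le> \<pi>1 * w1" "\<pi>1 * (1 - w1) \<le> \<pi>0 * (1 - x1)"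
    using e1_le_prior by (simp_all add: e1_def algebra_simps)
  show False
  proof (cases "\<pi>1 \<le> \<pi>0")
    case True
    have "\<pi>1 * x1 \<le> \<pi>0 * x1" using True by (intro mult_right_mono) auto
    moreover have "\<pi>1 * w1 < \<pi>1 * x1" using less prior by simp
    ultimately show False using * by linarith
  next
    case False
    have "\<pi>0 * (1 - x1) \<le> \<pi>1 * (1 - x1)" using False by (intro mult_right_mono) auto
    moreover have "\<pi>1 * (1 - x1) < \<pi>1 * (1 - w1)" using less prior by simp
    ultimately show False using * by linarith
  qed
qed

text \<open>\<open>\<phi>1\<close> is known only as a minimizer, not as a threshold test. Its worst
  case is nevertheless the least favorable pair, and varying one law while the other stays least
  favorable isolates each of the two errors.\<close>

lemma phi1_least_favorable:
  shows "P \<in> C0 \<Longrightarrow> (LINT y|P. pmf (\<phi>1 y) True) \<le> x1"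
    and "P \<in> C1 \<Longrightarrow> w1 \<le> (LINT y|P. pmf (\<phi>1 y) True)"
proof -
  note le = error1_le_P1_SL[of _ _ \<phi>1, unfolded P1_SL_phi1 e1_def]
  assume P: "P \<in> C0"
  show "(LINT y|P. pmf (\<phi>1 y) True) \<le> x1"
    using le[OF P Q_in_class(2)] error1_eq[OF P Q_in_class(2) phi1_rules] prior
    by (simp add: w1_def E1_def)
next
  note le = error1_le_P1_SL[of _ _ \<phi>1, unfolded P1_SL_phi1 e1_def]
  assume P: "P \<in> C1"
  show "w1 \<le> (LINT y|P. pmf (\<phi>1 y) True)"
    using le[OF Q_in_class(1) P] error1_eq[OF Q_in_class(1) P phi1_rules] prior
    by (simp add: x1_def E0_def)
qed

section \<open>Recursions under the least favorable pair and worst-case errors\<close>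

lemma traj_Q:
  "traj \<phi>1 \<phi> (\<lambda>_. density \<mu> q0) n = markov (A \<phi> False) (A \<phi> True) x1 n"
  "traj \<phi>1 \<phi> (\<lambda>_. density \<mu> q1) n = markov (D \<phi> False) (D \<phi> True) w1 n"
  by (induction n) (simp_all add: A_def D_def x1_def w1_def E0_def E1_def)

lemma traj_le_DD:
  assumes "\<phi> \<in> rules \<mu>" "\<And>j. P j \<in> C0" "\<And>j. P' j \<in> C1"
  shows "\<pi>0 * traj \<phi>1 \<phi> P n + \<pi>1 * (1 - traj \<phi>1 \<phi> P' n) \<le> DD \<phi> (Suc n)"
  using error_prob_le_P_DD[OF phi1_rules assms(1) class_prob, where P = P and P' = P'] assms prior by simp

lemma DD_le:
  assumes "\<phi> \<in> rules \<mu>"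
    and "\<And>P P'. (\<And>j. P j \<in> C0) \<Longrightarrow> (\<And>j. P' j \<in> C1) \<Longrightarrow>
      \<pi>0 * traj \<phi>1 \<phi> P n + \<pi>1 * (1 - traj \<phi>1 \<phi> P' n) \<le> c"
  shows "DD \<phi> (Suc n) \<le> c"
  using Q_in_class by (intro P_DD_le[OF phi1_rules assms(1) class_prob]) (auto intro: assms(2))

lemma err_le_DD:
  assumes "\<phi> \<in> rules \<mu>"
  shows "err (A \<phi> False) (A \<phi> True) (D \<phi> False) (D \<phi> True) n \<le> DD \<phi> (Suc n)"
  using traj_le_DD[OF assms, of "\<lambda>_. density \<mu> q0" "\<lambda>_. density \<mu> q1" n] Q_in_class
  by (simp add: traj_Q err_def)

lemma traj_class_unit:
  assumes "\<And>j. P j \<in> C0 \<union> C1"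
  shows "traj \<phi>1 \<phi> P n \<in> {0..1}"
  by (rule traj_unit) (use assms class_prob in blast)

lemma DD_unit:
  assumes "\<phi> \<in> rules \<mu>"
  shows "DD \<phi> (Suc n) \<in> {0..1}"
proof -
  have bounds: "0 \<le> \<pi>0 * traj \<phi>1 \<phi> P n + \<pi>1 * (1 - traj \<phi>1 \<phi> P' n)"
    "\<pi>0 * traj \<phi>1 \<phi> P n + \<pi>1 * (1 - traj \<phi>1 \<phi> P' n) \<le> 1"
    if "\<And>j. P j \<in> C0" "\<And>j. P' j \<in> C1" for P P'
  proof -
    have "traj \<phi>1 \<phi> P n \<in> {0..1}" "1 - traj \<phi>1 \<phi> P' n \<in> {0..1}"
      using traj_class_unit[of P \<phi> n] traj_class_unit[of P' \<phi> n] that by auto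
    from convex_unit[OF this(2,1), of \<pi>0] prior
    have "(1 - \<pi>0) * (1 - traj \<phi>1 \<phi> P' n) + \<pi>0 * traj \<phi>1 \<phi> P n \<in> {0..1}" by simp
    moreover have "1 - \<pi>0 = \<pi>1" using prior by simp
    ultimately show "0 \<le> \<pi>0 * traj \<phi>1 \<phi> P n + \<pi>1 * (1 - traj \<phi>1 \<phi> P' n)"
      "\<pi>0 * traj \<phi>1 \<phi> P n + \<pi>1 * (1 - traj \<phi>1 \<phi> P' n) \<le> 1" by simp_all
  qed
  show ?thesis
    using DD_le[OF assms bounds(2)] order_trans[OF bounds(1) traj_le_DD[OF assms],
        of "\<lambda>_. density \<mu> q0" "\<lambda>_. density \<mu> q1"] Q_in_class by auto
qed

lemma DD_le_Pmax:
  assumes "\<phi> \<in> rules \<mu>" "1 \<le> n"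
  shows "DD \<phi> (Suc n) \<le> Pmax \<phi>"
  unfolding Pmax_SL_def
proof (rule cSUP_upper)
  show "bdd_above (DD \<phi> ` {2..})"
  proof (rule bdd_aboveI2[where M = 1])
    fix k :: nat assume "k \<in> {2..}"
    thus "DD \<phi> k \<le> 1" using DD_unit[OF assms(1), of "k - 1"] by auto
  qed
qed (use assms in auto)

lemma Pmax_le:
  assumes "\<And>n. 1 \<le> n \<Longrightarrow> DD \<phi> (Suc n) \<le> c"
  shows "Pmax \<phi> \<le> c"
  unfolding Pmax_SL_def
proof (rule cSUP_least)
  fix k :: nat assume "k \<in> {2..}"
  thus "DD \<phi> k \<le> c" using assms[of "k - 1"] by auto
qed auto

text \<open>Domination compares the coefficients of every single step; since a larger previous
  probability of deciding 1 also raises the next one, the comparisons accumulate along the chain.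
  Together with \<open>err_le_DD\<close> the bound is an equality.\<close>

lemma DD_thr_rule_le:
  assumes r: "r0 \<in> {0..1}" "r1 \<in> {0..1}"
    and le: "E0 (thr t0 r0) \<le> E0 (thr t1 r1)" "E1 (thr t0 r0) \<le> E1 (thr t1 r1)"
  shows "DD (thr_rule t0 r0 t1 r1) (Suc n) \<le>
    err (E0 (thr t0 r0)) (E0 (thr t1 r1)) (E1 (thr t0 r0)) (E1 (thr t1 r1)) n"
proof (rule DD_le[OF thr_rule_rules[OF r]])
  fix P P' :: "nat \<Rightarrow> 'a measure"
  assume P: "\<And>j. P j \<in> C0" and P': "\<And>j. P' j \<in> C1"
  let ?\<phi> = "thr_rule t0 r0 t1 r1"
  note u0 = E0_unit[OF thr_tests[OF r(1)], of t0] E0_unit[OF thr_tests[OF r(2)], of t1]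
  note u1 = E1_unit[OF thr_tests[OF r(1)], of t0] E1_unit[OF thr_tests[OF r(2)], of t1]
  have "traj \<phi>1 ?\<phi> P n \<le> markov (E0 (thr t0 r0)) (E0 (thr t1 r1)) x1 n"
  proof (induction n)
    case (Suc n)
    show ?case
      using affine_mono[OF disjI2[OF le(1)] Suc thr_dominated(1)[OF P r(1)] thr_dominated(1)[OF P r(2)]
        traj_class_unit markov_unit[OF u0 unit(1)]] P
      by (simp add: pmf_thr_rule[OF r])
  qed (simp add: phi1_least_favorable P)
  moreover have "markov (E1 (thr t0 r0)) (E1 (thr t1 r1)) w1 n \<le> traj \<phi>1 ?\<phi> P' n"
  proof (induction n)
    case (Suc n)
    show ?case
      using affine_mono[OF disjI1[OF le(2)] Suc thr_dominated(2)[OF P' r(1)] thr_dominated(2)[OF P' r(2)]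
        markov_unit[OF u1 unit(2)] traj_class_unit] P'
      by (simp add: pmf_thr_rule[OF r])
  qed (simp add: phi1_least_favorable P')
  ultimately show "\<pi>0 * traj \<phi>1 ?\<phi> P n + \<pi>1 * (1 - traj \<phi>1 ?\<phi> P' n) \<le>
      err (E0 (thr t0 r0)) (E0 (thr t1 r1)) (E1 (thr t0 r0)) (E1 (thr t1 r1)) n"
    unfolding err_def using prior by (intro add_mono mult_left_mono) auto
qed

section \<open>Threshold rules as randomized likelihood ratio tests\<close>

lemma pmf_map_bernoulli:
  assumes "r \<in> {0..1}"
  shows "pmf (map_pmf f (bernoulli_pmf (1 - r))) True =
    (if f True then 1 - r else 0) + (if f False then r else 0)"
  using assms unfolding map_pmf_def pmf_bind_bool
  by (cases "f True"; cases "f False"; simp)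

lemma randomized_LRT_thr_rule:
  assumes "r0 \<in> {0..1}" "r1 \<in> {0..1}" "t1 < t0"
  shows "randomized_LRT \<mu> q0 q1 (thr_rule t0 r0 t1 r1)"
  unfolding randomized_LRT_def
\<comment> \<open>At \<open>t1\<close> a previous 1 survives with probability \<open>1 - p\<close>,
  which must be \<open>r1\<close>; at \<open>t0\<close> a previous 0 is overruled with probability
  \<open>1 - q\<close>, which must be \<open>r0\<close>. Strictness ensures that a tie for one test
  is decided outright by the other.\<close>
proof (rule exI[of _ t1], rule exI[of _ t0], rule exI[of _ "1 - r1"], rule exI[of _ "1 - r0"],
    intro conjI ballI allI)
  fix y u
  have eq: "thr_rule t0 r0 t1 r1 y u = p \<longleftrightarrow> (if u then thr t1 r1 y else thr t0 r0 y) = pmf p True" for p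
    by (metis pmf_bool_cong pmf_thr_rule[OF assms(1,2)])
  have sep: "t0 \<noteq> t1" "\<not> t0 < t1" using assms(3) by auto
  show "let l = ereal (q1 y / q0 y) in
    (l < t1 \<longrightarrow> thr_rule t0 r0 t1 r1 y u = return_pmf False) \<and>
    (l = t1 \<longrightarrow> thr_rule t0 r0 t1 r1 y u = map_pmf (\<lambda>b. if b then False else u) (bernoulli_pmf (1 - r1))) \<and>
    (t1 < l \<and> l < t0 \<longrightarrow> thr_rule t0 r0 t1 r1 y u = return_pmf u) \<and>
    (l = t0 \<longrightarrow> thr_rule t0 r0 t1 r1 y u = map_pmf (\<lambda>b. if b then u else True) (bernoulli_pmf (1 - r0))) \<and>
    (l > t0 \<longrightarrow> thr_rule t0 r0 t1 r1 y u = return_pmf True)"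
    unfolding Let_def eq pmf_map_bernoulli[OF assms(1)] pmf_map_bernoulli[OF assms(2)]
    using sep assms(3) by (cases u) (auto simp: thr_def)
qed (use assms in auto)

text \<open>Infinite thresholds put every observation into the region where the previous decision is
  kept. Copying is thus itself a likelihood ratio test, and an optimal one if no rule beats
  \<open>e1\<close>.\<close>

lemma copy_rule:
  defines "\<kappa> \<equiv> thr_rule \<infinity> 0 (-\<infinity>) 0"
  shows "\<kappa> \<in> rules \<mu>" "randomized_LRT \<mu> q0 q1 \<kappa>" "Pmax \<kappa> \<le> e1"
proof -
  show "\<kappa> \<in> rules \<mu>" "randomized_LRT \<mu> q0 q1 \<kappa>"
    unfolding \<kappa>_def by (rule thr_rule_rules randomized_LRT_thr_rule; simp)+
  have E: "E0 (thr \<infinity> 0) = 0" "E0 (thr (-\<infinity>) 0) = 1" "E1 (thr \<infinity> 0) = 0" "E1 (thr (-\<infinity>) 0) = 1"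
    unfolding thr_infty using const_tests[of 0] const_tests[of 1] by auto
  have "DD \<kappa> (Suc n) \<le> e1" for n
    using DD_thr_rule_le[of 0 0 \<infinity> "-\<infinity>" n] unfolding E \<kappa>_def by (simp add: err_def e1_def)
  thus "Pmax \<kappa> \<le> e1" by (intro Pmax_le)
qed

lemma err_one:
  "err a b c d 1 = \<pi>0 * ((1 - x1) * a + x1 * b) + \<pi>1 * (1 - ((1 - w1) * c + w1 * d))"
  by (simp add: err_def)

lemma err_const: "err a a c c 1 = \<pi>0 * a + \<pi>1 * (1 - c)"
  unfolding err_one by (simp add: algebra_simps)

text \<open>A rule reacting against the previous decision is no better than some test that ignores it.\<close>

lemma e1_le_err_reversed:
  assumes \<phi>: "\<phi> \<in> rules \<mu>" and rev: "A \<phi> True < A \<phi> False"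
  shows "e1 \<le> err (A \<phi> False) (A \<phi> True) (D \<phi> False) (D \<phi> True) 1"
proof -
  let ?x = "(1 - x1) * A \<phi> False + x1 * A \<phi> True" and ?w = "(1 - w1) * D \<phi> False + w1 * D \<phi> True"
  \<comment> \<open>If the power does not fall after a previous 1, the test used then has both the
    smaller size and the larger power. Otherwise the two tests are mixed as if the previous decision
    were drawn under Q0.\<close>
  have "\<exists>f\<in>tests. E0 f \<le> ?x \<and> ?w \<le> E1 f"
  proof (cases "D \<phi> False \<le> D \<phi> True")
    case True
    show ?thesis
    proof (intro bexI[OF _ rule_tests[OF \<phi>, of True]] conjI)
      have "(1 - x1) * A \<phi> True \<le> (1 - x1) * A \<phi> False"
        using rev unit(1) by (intro mult_left_mono) auto
      thus "E0 (\<lambda>y. pmf (\<phi> y True) True) \<le> ?x"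
        by (simp add: A_def algebra_simps)
      have "(1 - w1) * D \<phi> False \<le> (1 - w1) * D \<phi> True"
        using True unit(2) by (intro mult_left_mono) auto
      thus "?w \<le> E1 (\<lambda>y. pmf (\<phi> y True) True)"
        by (simp add: D_def algebra_simps)
    qed
  next
    case False
    note f = rule_tests[OF \<phi>, of False] rule_tests[OF \<phi>, of True]
    \<comment> \<open>Under Q1 the true mixing weight is \<open>w1\<close>. Using the smaller
      \<open>x1\<close> there puts more weight on the more powerful test.\<close>
    have "(w1 - x1) * D \<phi> True \<le> (w1 - x1) * D \<phi> False"
      using False x1_le_w1 by (intro mult_left_mono) auto
    hence "?w \<le> (1 - x1) * D \<phi> False + x1 * D \<phi> True"
      by (simp add: algebra_simps)
    thus ?thesis
      using E0_convex[OF f unit(1)] E1_convex[OF f unit(1)]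
      by (intro bexI[OF _ tests_convex[OF f unit(1)]]) (simp add: A_def D_def)
  qed
  then obtain f where f: "f \<in> tests" "E0 f \<le> ?x" "?w \<le> E1 f" by blast
  have "e1 \<le> \<pi>0 * E0 f + \<pi>1 * (1 - E1 f)" by (rule e1_le_test[OF f(1)])
  also have "\<dots> \<le> \<pi>0 * ?x + \<pi>1 * (1 - ?w)"
    using f prior by (intro add_mono mult_left_mono) auto
  finally show ?thesis unfolding err_one .
qed

section \<open>Improvement by Neyman-Pearson tests\<close>

lemma most_powerfulD:
  assumes "most_powerful a t r"
  shows "r \<in> {0..1}" "E0 (thr t r) = a" "f \<in> tests \<Longrightarrow> E0 f \<le> a \<Longrightarrow> E1 f \<le> E1 (thr t r)"
  using assms unfolding most_powerful_def by auto

lemma most_powerful_limit: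
  assumes "most_powerful a t r" "\<And>n. f n \<in> tests" "(\<lambda>n. E0 (f n)) \<longlonglongrightarrow> a" "(\<lambda>n. E1 (f n)) \<longlonglongrightarrow> d"
  shows "d \<le> E1 (thr t r)"
  using assms(1)[unfolded most_powerful_def, THEN conjunct2, THEN conjunct2, THEN conjunct2]
    assms(2-4) by blast

lemma most_powerful_mono:
  assumes "most_powerful a t0 r0" "most_powerful b t1 r1" "a \<le> b"
  shows "E1 (thr t0 r0) \<le> E1 (thr t1 r1)"
  using assms most_powerfulD(1,2)[OF assms(1)] by (intro most_powerfulD(3)[OF assms(2)] thr_tests) auto

text \<open>The sizes stay the same, so only the recursion under Q1 moves. It moves upwards, because
  the improved powers are ordered like the sizes.\<close>

lemma err_most_powerful_le:
  assumes mp: "most_powerful a t0 r0" "most_powerful b t1 r1" and ab: "a \<le> b"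
    and cd: "c \<in> {0..1}" "d \<in> {0..1}" "c \<le> E1 (thr t0 r0)" "d \<le> E1 (thr t1 r1)"
  shows "err a b (E1 (thr t0 r0)) (E1 (thr t1 r1)) n \<le> err a b c d n"
proof -
  note r = most_powerfulD(1)[OF mp(1)] most_powerfulD(1)[OF mp(2)]
  have "markov c d w1 n \<le> markov (E1 (thr t0 r0)) (E1 (thr t1 r1)) w1 n"
    using most_powerful_mono[OF mp ab] cd E1_unit[OF thr_tests[OF r(1)]] E1_unit[OF thr_tests[OF r(2)]]
    by (intro markov_mono) auto
  thus ?thesis using prior by (simp add: err_def)
qed

text \<open>Both tests may have the same threshold when \<open>l\<^sup>*\<close> has an atom there. Then one of them can be
  replaced by the test deciding 1 iff \<open>l\<^sup>* > 1\<close>: all errors being at most \<open>min \<pi>0 \<pi>1\<close>, the previous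
  decision is informative enough for this to lower the error of every agent.\<close>

lemma strict_thresholds:
  assumes mp: "most_powerful a t0 r0" "most_powerful b t1 r1" and ab: "a < b"
    and e1: "\<And>n. err a b (E1 (thr t0 r0)) (E1 (thr t1 r1)) n \<le> e1"
  obtains s0 p0 s1 p1 where "p0 \<in> {0..1}" "p1 \<in> {0..1}" "s1 < s0"
    "E0 (thr s0 p0) \<le> E0 (thr s1 p1)" "E1 (thr s0 p0) \<le> E1 (thr s1 p1)"
    "\<And>n. err (E0 (thr s0 p0)) (E0 (thr s1 p1)) (E1 (thr s0 p0)) (E1 (thr s1 p1)) n
      \<le> err a b (E1 (thr t0 r0)) (E1 (thr t1 r1)) n"
proof -
  note r = most_powerfulD(1)[OF mp(1)] most_powerfulD(1)[OF mp(2)]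
  note lev = most_powerfulD(2)[OF mp(1)] most_powerfulD(2)[OF mp(2)]
  note cd = most_powerful_mono[OF mp less_imp_le[OF ab]]
  note T = thr_tests[OF r(1), of t0] thr_tests[OF r(2), of t1]
  note u = E0_unit[OF T(1)] E0_unit[OF T(2)] E1_unit[OF T(1)] E1_unit[OF T(2)]
  define c where "c = E1 (thr t0 r0)"
  define d where "d = E1 (thr t1 r1)"
  have e: "err a b c d n \<le> \<pi>0" "err a b c d n \<le> \<pi>1" for n
    using e1[of n] e1_le_prior by (auto simp: c_def d_def)
  have x: "markov a b x1 n \<in> {0..1}" and w: "markov c d w1 n \<in> {0..1}" for n
    using u lev by (auto simp: c_def d_def intro!: markov_unit unit(1,2) simp del: atLeastAtMost_iff)
  have "t1 \<le> t0"
  proof (rule ccontr)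
    assume "\<not> t1 \<le> t0"
    hence "b \<le> a" unfolding lev[symmetric]
      by (intro E0_mono T thr_antimono r) auto
    thus False using ab by simp
  qed
  then consider "t1 < t0" | "t0 = t1" by fastforce
  thus thesis
  proof cases
    case 1
    show thesis by (rule that[OF r 1]) (use lev cd ab in auto)
  next
    case 2
    define t where "t = t0"
    have t: "t0 = t" "t1 = t" using 2 by (auto simp: t_def)
    \<comment> \<open>At a common infinite threshold both tests are the same constant, and at
      threshold 1 the randomization does not affect the size. Each would give
      \<open>a = b\<close>.\<close>
    have "t \<noteq> \<infinity>" "t \<noteq> -\<infinity>"
      using lev ab const_tests[of 0] const_tests[of 1] unfolding t by (auto simp: thr_infty)
    moreover have "t \<noteq> 1"
      using lev ab tie_null[of r0 r1] unfolding t by auto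
    moreover define g where "g = thr 1 0"
    have g: "g \<in> tests" unfolding g_def by (rule thr_tests) simp
    \<comment> \<open>At slope 1, passing from any test to \<open>g\<close> raises the power by at
      least as much as the size.\<close>
    have np: "E1 f - E1 g \<le> E0 f - E0 g" if "f \<in> tests" for f
      using neyman_pearson[OF that, of 0 1] by (simp add: g_def one_ereal_def)
    ultimately consider "1 < t" | "t < 1" by (meson linorder_neqE)
    thus thesis
    proof cases
      case 1
      have b': "b \<le> E0 g"
        unfolding g_def lev[symmetric] t using 1 r by (intro E0_mono thr_tests thr_antimono) auto
      have d': "E0 g - b \<le> E1 g - d" "E0 g - a \<le> E1 g - c"
        using np[OF T(1)] np[OF T(2)] lev by (auto simp: c_def d_def)
      \<comment> \<open>The test after a previous 1 is replaced. An error of at most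
        \<open>\<pi>1\<close> says exactly that a decision 1 is, with the priors as weights, more
        often right than wrong, so keeping it more often pays off.\<close>
      have "\<pi>0 * (markov a (E0 g) x1 n - markov a b x1 n) \<le> \<pi>1 * (markov c (E1 g) w1 n - markov c d w1 n)" for n
      proof (rule conjunct1[OF markov_raise_weighted])
        show "\<pi>0 * markov a b x1 n \<le> \<pi>1 * markov c d w1 n" for n
          using e(2)[of n] by (simp add: err_def algebra_simps)
      qed (use prior ab b' d' x w in auto)
      hence le: "err a (E0 g) c (E1 g) n \<le> err a b c d n" for n
        using spec[of "\<lambda>n. \<pi>0 * (markov a (E0 g) x1 n - markov a b x1 n) \<le>
          \<pi>1 * (markov c (E1 g) w1 n - markov c d w1 n)" n] by (simp add: err_def algebra_simps)
      show thesis
        by (rule that[of r0 0 1 t, folded g_def])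
          (use r 1 b' d' ab lev le cd in \<open>auto simp: t c_def d_def\<close>)
    next
      case 2
      have a': "E0 g \<le> a"
        unfolding g_def lev[symmetric] t using 2 r by (intro E0_mono thr_tests thr_antimono) auto
      have c': "c - E1 g \<le> a - E0 g" "d - E1 g \<le> b - E0 g"
        using np[OF T(1)] np[OF T(2)] lev by (auto simp: c_def d_def)
      have g': "E1 g \<le> c"
        unfolding g_def c_def t using 2 r by (intro E1_mono thr_tests thr_antimono) auto
      \<comment> \<open>The mirror image: the test after a previous 0 is replaced, and an error of
        at most \<open>\<pi>0\<close> makes a decision 0 trustworthy.\<close>
      have "\<pi>1 * (markov (1 - d) (1 - E1 g) (1 - w1) n - markov (1 - d) (1 - c) (1 - w1) n) \<le>
        \<pi>0 * (markov (1 - b) (1 - E0 g) (1 - x1) n - markov (1 - b) (1 - a) (1 - x1) n)" for n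
      proof (rule conjunct1[OF markov_raise_weighted])
        show "\<pi>1 * markov (1 - d) (1 - c) (1 - w1) n \<le> \<pi>0 * markov (1 - b) (1 - a) (1 - x1) n" for n
          using e(1)[of n] by (simp add: err_def markov_reflect[symmetric] algebra_simps)
      qed (use prior ab a' g' c' x w cd in \<open>auto simp: markov_reflect[symmetric] c_def d_def\<close>)
      hence le: "err (E0 g) b (E1 g) d n \<le> err a b c d n" for n
        using spec[of "\<lambda>n. \<pi>1 * (markov (1 - d) (1 - E1 g) (1 - w1) n - markov (1 - d) (1 - c) (1 - w1) n) \<le>
        \<pi>0 * (markov (1 - b) (1 - E0 g) (1 - x1) n - markov (1 - b) (1 - a) (1 - x1) n)" n]
        by (simp add: err_def markov_reflect[symmetric] algebra_simps)
      show thesis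
        by (rule that[of 0 r1 t 1, folded g_def])
          (use r 2 a' g' ab lev le cd in \<open>auto simp: t c_def d_def\<close>)
    qed
  qed
qed

section \<open>Existence of an optimal threshold rule\<close>

lemma err_tendsto:
  assumes "a \<longlonglongrightarrow> a'" "b \<longlonglongrightarrow> b'" "c \<longlonglongrightarrow> c'" "d \<longlonglongrightarrow> d'"
  shows "(\<lambda>i. err (a i) (b i) (c i) (d i) n) \<longlonglongrightarrow> err a' b' c' d' n"
  unfolding err_def by (intro tendsto_intros tendsto_markov assms)

text \<open>A minimizing sequence is followed only through its sizes and powers. The limit point
  need not belong to any limit of the rules; semicontinuity of the ROC curve supplies tests that do
  at least as well, and for threshold rules the bound on Q-errors is a bound on worst-case
  errors.\<close>

lemma minimizer_exists:
  "\<exists>\<phi>\<in>rules \<mu>. randomized_LRT \<mu> q0 q1 \<phi> \<and> (\<forall>\<psi>\<in>rules \<mu>. Pmax \<phi> \<le> Pmax \<psi>)"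
proof -
  define V where "V = (INF \<psi>\<in>rules \<mu>. Pmax \<psi>)"
  have nonneg: "0 \<le> Pmax \<psi>" if "\<psi> \<in> rules \<mu>" for \<psi>
    using DD_unit[OF that, of 1] DD_le_Pmax[OF that, of 1] by simp
  have bdd: "bdd_below (Pmax ` rules \<mu>)"
    using nonneg by (intro bdd_belowI[of _ 0]) auto
  have V: "V \<le> Pmax \<psi>" if "\<psi> \<in> rules \<mu>" for \<psi>
    unfolding V_def by (intro cINF_lower bdd that)
  have ne: "rules \<mu> \<noteq> {}" using copy_rule(1) by auto
  have "\<exists>\<phi>\<in>rules \<mu>. randomized_LRT \<mu> q0 q1 \<phi> \<and> Pmax \<phi> \<le> V"
  proof (cases "e1 \<le> V")
    case True
    thus ?thesis using copy_rule order_trans by blast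
  next
    case False
    \<comment> \<open>The slack starts at \<open>e1 - V\<close>, so already the first rule of the
      sequence beats \<open>e1\<close>, which the ordering \<open>ab\<close> relies on.\<close>
    define z where "z n = V + (e1 - V) / real (Suc n)" for n
    have z: "V < z n" "z n \<le> e1" for n
      using False divide_left_mono[of 1 "real (Suc n)" "e1 - V"] by (auto simp: z_def)
    have "\<forall>n. \<exists>\<psi>\<in>rules \<mu>. Pmax \<psi> < z n"
      using z(1) bdd ne unfolding V_def by (simp add: cINF_less_iff)
    then obtain \<psi> where \<psi>: "\<And>n. \<psi> n \<in> rules \<mu>" "\<And>n. Pmax (\<psi> n) < z n" by metis
    let ?a = "\<lambda>n. A (\<psi> n) False" and ?b = "\<lambda>n. A (\<psi> n) True"
      and ?c = "\<lambda>n. D (\<psi> n) False" and ?d = "\<lambda>n. D (\<psi> n) True"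
    have err_le: "err (?a n) (?b n) (?c n) (?d n) k \<le> Pmax (\<psi> n)" if "1 \<le> k" for n k
      using err_le_DD[OF \<psi>(1), of n k] DD_le_Pmax[OF \<psi>(1) that, of n] by linarith
    have ab: "?a n \<le> ?b n" for n
      using e1_le_err_reversed[OF \<psi>(1), of n] err_le[of 1 n] \<psi>(2)[of n] z(2)[of n] by force
    define v where "v n = (?a n, ?b n, ?c n, ?d n)" for n
    have "seq_compact ({0..1} \<times> {0..1} \<times> {0..1} \<times> {0..1 :: real} :: (real \<times> real \<times> real \<times> real) set)"
      by (intro compact_imp_seq_compact compact_Times compact_Icc)
    moreover have "\<And>n. v n \<in> {0..1} \<times> {0..1} \<times> {0..1} \<times> {0..1}"
      using unit(3,4)[OF \<psi>(1)] by (simp add: v_def del: atLeastAtMost_iff)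
    ultimately obtain l s where l: "l \<in> {0..1} \<times> {0..1} \<times> {0..1} \<times> {0..1}"
      and s: "strict_mono s" "(v \<circ> s) \<longlonglongrightarrow> l" by (elim seq_compactE[where f = v]) blast+
    obtain a b c d where l_eq: "l = (a, b, c, d)" by (metis prod.exhaust)
    have lim: "(\<lambda>n. ?a (s n)) \<longlonglongrightarrow> a" "(\<lambda>n. ?b (s n)) \<longlonglongrightarrow> b" "(\<lambda>n. ?c (s n)) \<longlonglongrightarrow> c" "(\<lambda>n. ?d (s n)) \<longlonglongrightarrow> d"
      using tendsto_fst[OF s(2)] tendsto_fst[OF tendsto_snd[OF s(2)]]
        tendsto_fst[OF tendsto_snd[OF tendsto_snd[OF s(2)]]]
        tendsto_snd[OF tendsto_snd[OF tendsto_snd[OF s(2)]]]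
      by (simp_all add: l_eq v_def o_def)
    have abcd: "a \<in> {0..1}" "b \<in> {0..1}" "c \<in> {0..1}" "d \<in> {0..1}" using l by (auto simp: l_eq)
    have ab': "a \<le> b" using lim(1,2) ab by (intro LIMSEQ_le[OF lim(1,2)]) auto
    have z_lim: "z \<longlonglongrightarrow> V"
      unfolding z_def using tendsto_add[OF tendsto_const[of V] tendsto_mult_right_zero[OF LIMSEQ_inverse_real_of_nat, of "e1 - V"]]
      by (simp add: field_simps)
    have limit_err: "err a b c d k \<le> V" if "1 \<le> k" for k
    proof (rule LIMSEQ_le)
      show "(\<lambda>n. err (?a (s n)) (?b (s n)) (?c (s n)) (?d (s n)) k) \<longlonglongrightarrow> err a b c d k"
        by (intro err_tendsto lim)
      show "(\<lambda>n. z (s n)) \<longlonglongrightarrow> V" using LIMSEQ_subseq_LIMSEQ[OF z_lim s(1)] by (simp add: o_def)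
      show "\<exists>N. \<forall>n\<ge>N. err (?a (s n)) (?b (s n)) (?c (s n)) (?d (s n)) k \<le> z (s n)"
        using err_le[OF that] \<psi>(2) less_imp_le order_trans by blast
    qed
    obtain t0 r0 t1 r1 where mp: "most_powerful a t0 r0" "most_powerful b t1 r1"
      using most_powerful_exists abcd by metis
    let ?c' = "E1 (thr t0 r0)" and ?d' = "E1 (thr t1 r1)"
    have c: "c \<le> ?c'"
      using lim(1,3) unfolding A_def D_def
      by (rule most_powerful_limit[OF mp(1) rule_tests[OF \<psi>(1)]])
    have d: "d \<le> ?d'"
      using lim(2,4) unfolding A_def D_def
      by (rule most_powerful_limit[OF mp(2) rule_tests[OF \<psi>(1)]])
    have err': "err a b ?c' ?d' k \<le> V" if "1 \<le> k" for k
      using err_most_powerful_le[OF mp ab' abcd(3,4) c d] limit_err[OF that] order_trans by blast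
    \<comment> \<open>Equal sizes give equal powers: agent 2 would ignore its predecessor, and a
      single test cannot beat \<open>e1\<close>.\<close>
    have "a \<noteq> b"
    proof
      assume [simp]: "a = b"
      have "?d' = ?c'"
        using most_powerful_mono[OF mp] most_powerful_mono[OF mp(2,1)] by auto
      hence "\<pi>0 * a + \<pi>1 * (1 - ?c') \<le> V"
        using err'[of 1] err_const[of a ?c'] by simp
      moreover have "e1 \<le> \<pi>0 * a + \<pi>1 * (1 - ?c')"
        using e1_le_test[OF thr_tests[OF most_powerfulD(1)[OF mp(1)]], of t0] most_powerfulD(2)[OF mp(1)] by simp
      ultimately show False using False by simp
    qed
    hence "a < b" using ab' by simp
    have le_e1: "err a b ?c' ?d' k \<le> e1" for k
      using err'[of k] False err_0[of a b ?c' ?d'] by (cases k) auto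
    obtain s0 p0 s1 p1 where sp: "p0 \<in> {0..1}" "p1 \<in> {0..1}" "s1 < s0"
      "E0 (thr s0 p0) \<le> E0 (thr s1 p1)" "E1 (thr s0 p0) \<le> E1 (thr s1 p1)"
      "\<And>n. err (E0 (thr s0 p0)) (E0 (thr s1 p1)) (E1 (thr s0 p0)) (E1 (thr s1 p1)) n \<le> err a b ?c' ?d' n"
      using strict_thresholds[OF mp \<open>a < b\<close> le_e1] by metis
    show ?thesis
    proof (intro bexI conjI)
      show "thr_rule s0 p0 s1 p1 \<in> rules \<mu>" by (rule thr_rule_rules[OF sp(1,2)])
      show "randomized_LRT \<mu> q0 q1 (thr_rule s0 p0 s1 p1)" by (rule randomized_LRT_thr_rule[OF sp(1-3)])
      show "Pmax (thr_rule s0 p0 s1 p1) \<le> V"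
        using DD_thr_rule_le[OF sp(1,2,4,5)] sp(6) err' by (intro Pmax_le) (meson order_trans)
    qed
  qed
  thus ?thesis using V order_trans by blast
qed

section \<open>Shape of the error sequence of a minimizer\<close>

lemma err_increment:
  "err a b c d (Suc n) - err a b c d n =
    (\<pi>0 * (markov a b x1 1 - x1)) * (b - a) ^ n + (- \<pi>1 * (markov c d w1 1 - w1)) * (d - c) ^ n"
proof -
  have "err a b c d (Suc n) - err a b c d n =
      \<pi>0 * (markov a b x1 (Suc n) - markov a b x1 n) - \<pi>1 * (markov c d w1 (Suc n) - markov c d w1 n)"
    by (simp add: err_def algebra_simps)
  thus ?thesis unfolding markov_diff by (simp add: mult_ac)
qed

lemma err_convergent_bound:
  assumes "a \<le> b" "c \<le> d" "a \<in> {0..1}" "b \<in> {0..1}" "c \<in> {0..1}" "d \<in> {0..1}"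
    and "err a b c d 1 \<le> e1"
  obtains l where "err a b c d \<longlonglongrightarrow> l" "\<And>n. 1 \<le> n \<Longrightarrow> err a b c d n \<le> max (err a b c d 1) l"
proof -
  obtain x w where "markov a b x1 \<longlonglongrightarrow> x" "markov c d w1 \<longlonglongrightarrow> w"
    using convergent_markov assms unit(1,2) unfolding convergent_def by metis
  hence l: "err a b c d \<longlonglongrightarrow> \<pi>0 * x + \<pi>1 * (1 - w)"
    unfolding err_def by (intro tendsto_intros)
  show thesis
    by (rule that[OF l], rule exp_sum_increments_bound[OF err_increment _ _ _ l])
      (use assms in \<open>auto simp: err_0\<close>)
qed

text \<open>The Q-errors of \<open>\<phi>\<close> may lie below its worst-case errors, so bounding
  the former says nothing about \<open>Pmax \<phi>\<close>. The improved rule has no such gap; its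
  errors at agent 2 and in the limit do not exceed those of \<open>\<phi>\<close>, and these two
  control all of its errors.\<close>

lemma Pmax_minimizer:
  assumes \<phi>: "\<phi> \<in> rules \<mu>" and min: "\<And>\<psi>. \<psi> \<in> rules \<mu> \<Longrightarrow> Pmax \<phi> \<le> Pmax \<psi>"
    and l: "(\<lambda>n. DD \<phi> (Suc n)) \<longlonglongrightarrow> l"
  shows "Pmax \<phi> = max (DD \<phi> 2) l"
proof (rule antisym)
  have "DD \<phi> 2 \<le> Pmax \<phi>" using DD_le_Pmax[OF \<phi>, of 1] by (simp add: numeral_2_eq_2)
  moreover have "l \<le> Pmax \<phi>"
    using DD_le_Pmax[OF \<phi>] by (intro LIMSEQ_le_const2[OF l]) auto
  ultimately show "max (DD \<phi> 2) l \<le> Pmax \<phi>" by simp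
  show "Pmax \<phi> \<le> max (DD \<phi> 2) l"
  proof (rule ccontr)
    assume less: "\<not> Pmax \<phi> \<le> max (DD \<phi> 2) l"
    let ?a = "A \<phi> False" and ?b = "A \<phi> True" and ?c = "D \<phi> False" and ?d = "D \<phi> True"
    note err_DD = err_le_DD[OF \<phi>]
    have err1: "err ?a ?b ?c ?d 1 < e1"
      using less err_DD[of 1] min[OF copy_rule(1)] copy_rule(3) by (simp add: numeral_2_eq_2)
    have ab: "?a \<le> ?b" using e1_le_err_reversed[OF \<phi>] err1 by force
    obtain t0 r0 t1 r1 where mp: "most_powerful ?a t0 r0" "most_powerful ?b t1 r1"
      using most_powerful_exists unit(3)[OF \<phi>] by metis
    note r = most_powerfulD(1)[OF mp(1)] most_powerfulD(1)[OF mp(2)]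
    note lev = most_powerfulD(2)[OF mp(1)] most_powerfulD(2)[OF mp(2)]
    let ?c' = "E1 (thr t0 r0)" and ?d' = "E1 (thr t1 r1)"
    have "?c \<le> ?c'" "?d \<le> ?d'"
      unfolding D_def by (rule most_powerfulD(3)[OF mp(1)] most_powerfulD(3)[OF mp(2)];
        use rule_tests[OF \<phi>] in \<open>simp add: A_def\<close>)+
    hence le: "err ?a ?b ?c' ?d' n \<le> err ?a ?b ?c ?d n" for n
      by (intro err_most_powerful_le[OF mp ab] unit(4)[OF \<phi>])
    note cd = most_powerful_mono[OF mp ab]
    have "err ?a ?b ?c' ?d' 1 \<le> e1" using le[of 1] err1 by simp
    then obtain l' where l': "err ?a ?b ?c' ?d' \<longlonglongrightarrow> l'"
      "\<And>n. 1 \<le> n \<Longrightarrow> err ?a ?b ?c' ?d' n \<le> max (err ?a ?b ?c' ?d' 1) l'"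
      using err_convergent_bound[OF ab cd unit(3)[OF \<phi>] unit(3)[OF \<phi>]
        E1_unit[OF thr_tests[OF r(1)]] E1_unit[OF thr_tests[OF r(2)]]] by metis
    have "l' \<le> l"
      using le err_DD order_trans by (intro LIMSEQ_le[OF l'(1) l]) blast
    moreover have "err ?a ?b ?c' ?d' 1 \<le> DD \<phi> 2"
      using le[of 1] err_DD[of 1] by (simp add: numeral_2_eq_2)
    ultimately have "err ?a ?b ?c' ?d' n \<le> max (DD \<phi> 2) l" if "1 \<le> n" for n
      using l'(2)[OF that] by linarith
    hence "DD (thr_rule t0 r0 t1 r1) (Suc n) \<le> max (DD \<phi> 2) l" if "1 \<le> n" for n
      using DD_thr_rule_le[OF r, of t0 t1 n] that ab cd unfolding lev by (meson order_trans)
    hence "Pmax (thr_rule t0 r0 t1 r1) \<le> max (DD \<phi> 2) l" by (rule Pmax_le)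
    thus False using min[OF thr_rule_rules[OF r]] less by (meson order_trans)
  qed
qed

end

section \<open>Convergence of the errors\<close>

text \<open>Convergence for an arbitrary rule needs information about all laws of the classes, not
  only about their effect on threshold tests: each contains a fraction \<open>\<kappa>\<close> of
  the nominal law.\<close>

locale robust_nominal = robust_pair \<mu> q0 q1 C0 C1 \<pi>0 \<pi>1 \<phi>1
  for \<mu> :: "'a measure" and q0 q1 C0 C1 \<pi>0 \<pi>1 \<phi>1 +
  fixes p0 p1 :: "'a \<Rightarrow> real" and \<kappa> :: real
  assumes p_meas [measurable]: "p0 \<in> borel_measurable \<mu>" "p1 \<in> borel_measurable \<mu>"
    and p_pos: "\<And>y. y \<in> space \<mu> \<Longrightarrow> 0 < p0 y" "\<And>y. y \<in> space \<mu> \<Longrightarrow> 0 < p1 y"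
    and p_in_class: "density \<mu> p0 \<in> C0" "density \<mu> p1 \<in> C1"
    and kappa: "0 < \<kappa>"
    and nominal_part: "\<And>P f. P \<in> C0 \<Longrightarrow> f \<in> tests \<Longrightarrow> \<kappa> * (LINT y|density \<mu> p0. f y) \<le> (LINT y|P. f y)"
      "\<And>P f. P \<in> C1 \<Longrightarrow> f \<in> tests \<Longrightarrow> \<kappa> * (LINT y|density \<mu> p1. f y) \<le> (LINT y|P. f y)"
begin

lemma class_integrable:
  assumes "P \<in> C0 \<union> C1" "f \<in> tests"
  shows "integrable P f"
proof -
  interpret prob_space P using class_prob assms by blast
  have "f \<in> borel_measurable P"
    using class_prob[OF assms(1)] assms(2) by (auto simp: tests_def cong: measurable_cong_sets)
  thus ?thesis using assms(2) by (intro integrable_const_bound[of _ 1]) (auto simp: tests_def)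
qed

text \<open>Positive densities give both nominal laws the null sets of \<open>\<mu>\<close>, so a
  rule that is degenerate under one hypothesis is degenerate under both.\<close>

lemma nominal_AE_zero:
  assumes f: "f \<in> tests" and zero: "(LINT y|density \<mu> p0. f y) = 0 \<or> (LINT y|density \<mu> p1. f y) = 0"
  shows "AE y in \<mu>. f y = 0"
proof -
  have *: "AE y in \<mu>. f y = 0"
    if "(LINT y|density \<mu> p. f y) = 0" "density \<mu> p \<in> C0 \<union> C1" "p \<in> borel_measurable \<mu>"
      "\<And>y. y \<in> space \<mu> \<Longrightarrow> 0 < p y" for p :: "'a \<Rightarrow> real"
  proof -
    have "AE y in density \<mu> p. f y = 0"
      using that(1) f class_integrable[OF that(2) f]
      by (subst (asm) integral_nonneg_eq_0_iff_AE) (auto simp: tests_def)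
    thus ?thesis
      using that(3,4) by (auto simp: AE_density elim!: AE_mp intro!: AE_I2)
  qed
  show ?thesis using zero *[of p0] *[of p1] p_in_class p_pos by auto
qed

text \<open>Away from the two degenerate cases the recursion contracts uniformly over the classes. If \<open>\<phi>\<close>
  almost surely copies, a further agent with the nominal law changes nothing, so the errors increase;
  if it almost surely negates, \<open>Pmax \<phi> \<le> e1\<close> forces all errors to be \<open>1/2\<close>.\<close>

lemma convergent_DD:
  assumes \<phi>: "\<phi> \<in> rules \<mu>" and Pmax: "Pmax \<phi> \<le> e1"
  shows "convergent (\<lambda>n. DD \<phi> (Suc n))"
proof -
  let ?f = "\<lambda>u y. pmf (\<phi> y u) True"
  \<comment> \<open>For a fair previous decision, \<open>g\<close> is the probability of not copying
    it and \<open>h\<close> that of not negating it. Their integrals measure how far the slope of a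
    step is from 1 and from -1.\<close>
  define g where "g y = (1 - 1 / 2) * (1 - ?f True y) + 1 / 2 * ?f False y" for y
  define h where "h y = (1 - 1 / 2) * (1 - ?f False y) + 1 / 2 * ?f True y" for y
  have f: "?f u \<in> tests" "(\<lambda>y. 1 - ?f u y) \<in> tests" for u
    using rule_tests[OF \<phi>, of u] by (auto simp: tests_def)
  have gh: "g \<in> tests" "h \<in> tests"
    unfolding g_def h_def by (rule tests_convex; use f in simp)+
  let ?m = "\<lambda>P u. LINT y|P. ?f u y"
  have slope: "?m P True - ?m P False = 1 - 2 * (LINT y|P. g y)"
    "?m P True - ?m P False = 2 * (LINT y|P. h y) - 1" if P: "P \<in> C0 \<union> C1" for P
  proof -
    interpret prob_space P using class_prob P by blast
    note int = class_integrable[OF P f(1)[of True]] class_integrable[OF P f(1)[of False]]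
    show "?m P True - ?m P False = 1 - 2 * (LINT y|P. g y)"
      "?m P True - ?m P False = 2 * (LINT y|P. h y) - 1"
      using int by (simp_all add: g_def h_def prob_space field_simps)
  qed
  define N where "N = {LINT y|density \<mu> p0. g y, LINT y|density \<mu> p0. h y,
    LINT y|density \<mu> p1. g y, LINT y|density \<mu> p1. h y}"
  have "\<And>x. x \<in> N \<Longrightarrow> 0 \<le> x"
    using gh unfolding N_def tests_def by auto
  then consider "\<And>x. x \<in> N \<Longrightarrow> 0 < x" | "AE y in \<mu>. g y = 0" | "AE y in \<mu>. h y = 0"
    using nominal_AE_zero[OF gh(1)] nominal_AE_zero[OF gh(2)] unfolding N_def
    by (metis (no_types, lifting) empty_iff insert_iff order_le_less)
  thus ?thesis
  proof cases
    case 1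
    \<comment> \<open>The nominal part keeps the integrals of \<open>g\<close> and \<open>h\<close>
      above \<open>\<kappa> * Min N\<close> under every law of either class.\<close>
    define L where "L = 1 - 2 * \<kappa> * Min N"
    have N: "finite N" "N \<noteq> {}" by (auto simp: N_def)
    have L: "\<bar>?m P True - ?m P False\<bar> \<le> L" if P: "P \<in> C0 \<union> C1" for P
    proof -
      have "\<exists>x\<in>N. \<kappa> * x \<le> (LINT y|P. g y)" "\<exists>x\<in>N. \<kappa> * x \<le> (LINT y|P. h y)"
        using P nominal_part gh unfolding N_def by blast+
      moreover have "\<kappa> * Min N \<le> \<kappa> * x" if "x \<in> N" for x
        using that N kappa by simp
      ultimately have "\<kappa> * Min N \<le> (LINT y|P. g y)" "\<kappa> * Min N \<le> (LINT y|P. h y)"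
        by (meson order_trans)+
      thus ?thesis using slope[OF P] by (simp add: L_def abs_le_iff)
    qed
    have "0 \<le> L" using L[of "density \<mu> q0"] Q_in_class by fastforce
    moreover have "L < 1" using 1 N kappa by (simp add: L_def)
    moreover have "\<bar>DD \<phi> (Suc (Suc n)) - DD \<phi> (Suc n)\<bar> \<le> L ^ n" for n
    proof -
      \<comment> \<open>\<open>S\<close> drops the second law and \<open>U\<close> repeats the first
        one, so that \<open>S\<close> undoes \<open>U\<close>. One direction shortens a family for
        agent \<open>n + 2\<close>, the other lengthens one for agent \<open>n + 1\<close>.\<close>
      define S where "S P = (\<lambda>j. if j \<le> 1 then P j else P (Suc j))" for P :: "nat \<Rightarrow> 'a measure"
      define U where "U P = (\<lambda>j. if j \<le> 1 then P j else P (j - 1))" for P :: "nat \<Rightarrow> 'a measure"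
      have SU: "S (U P) = P" for P by (auto simp: S_def U_def)
      have diff: "\<bar>traj \<phi>1 \<phi> P (Suc n) - traj \<phi>1 \<phi> (S P) n\<bar> \<le> L ^ n" if P: "\<And>j. P j \<in> C0 \<union> C1" for P
        unfolding S_def using class_prob[OF P] L[OF P] by (intro traj_shift_diff) auto
      have comb: "\<bar>(\<pi>0 * a + \<pi>1 * (1 - b)) - (\<pi>0 * a' + \<pi>1 * (1 - b'))\<bar> \<le> L ^ n"
        if "\<bar>a - a'\<bar> \<le> L ^ n" "\<bar>b - b'\<bar> \<le> L ^ n" for a a' b b'
      proof -
        have "\<bar>(\<pi>0 * a + \<pi>1 * (1 - b)) - (\<pi>0 * a' + \<pi>1 * (1 - b'))\<bar> = \<bar>\<pi>0 * (a - a') - \<pi>1 * (b - b')\<bar>"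
          by (simp add: algebra_simps)
        also have "\<dots> \<le> \<bar>\<pi>0 * (a - a')\<bar> + \<bar>\<pi>1 * (b - b')\<bar>" by (rule abs_triangle_ineq4)
        also have "\<dots> \<le> \<pi>0 * L ^ n + \<pi>1 * L ^ n"
          unfolding abs_mult using prior that by (intro add_mono mult_mono) auto
        also have "\<dots> = L ^ n" using prior(3) by (simp flip: distrib_right)
        finally show ?thesis .
      qed
      have "DD \<phi> (Suc (Suc n)) \<le> DD \<phi> (Suc n) + L ^ n"
      proof (rule DD_le[OF \<phi>])
        fix P P' :: "nat \<Rightarrow> 'a measure"
        assume P: "\<And>j. P j \<in> C0" and P': "\<And>j. P' j \<in> C1"
        have "\<pi>0 * traj \<phi>1 \<phi> (S P) n + \<pi>1 * (1 - traj \<phi>1 \<phi> (S P') n) \<le> DD \<phi> (Suc n)"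
          using P P' by (intro traj_le_DD[OF \<phi>]) (auto simp: S_def)
        thus "\<pi>0 * traj \<phi>1 \<phi> P (Suc n) + \<pi>1 * (1 - traj \<phi>1 \<phi> P' (Suc n)) \<le> DD \<phi> (Suc n) + L ^ n"
          using comb[OF diff diff, of P P'] P P' by (auto simp: abs_le_iff simp del: traj.simps)
      qed
      moreover have "DD \<phi> (Suc n) \<le> DD \<phi> (Suc (Suc n)) + L ^ n"
      proof (rule DD_le[OF \<phi>])
        fix P P' :: "nat \<Rightarrow> 'a measure"
        assume P: "\<And>j. P j \<in> C0" and P': "\<And>j. P' j \<in> C1"
        have UP: "U P j \<in> C0" "U P' j \<in> C1" for j
          using P P' by (auto simp: U_def)
        have "\<pi>0 * traj \<phi>1 \<phi> (U P) (Suc n) + \<pi>1 * (1 - traj \<phi>1 \<phi> (U P') (Suc n)) \<le> DD \<phi> (Suc (Suc n))"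
          using UP by (intro traj_le_DD[OF \<phi>])
        thus "\<pi>0 * traj \<phi>1 \<phi> P n + \<pi>1 * (1 - traj \<phi>1 \<phi> P' n) \<le> DD \<phi> (Suc (Suc n)) + L ^ n"
          using comb[OF diff diff, of "U P" "U P'"] UP unfolding SU
          by (auto simp: abs_le_iff simp del: traj.simps)
      qed
      ultimately show ?thesis by (simp add: abs_le_iff)
    qed
    ultimately show ?thesis by (intro geometric_increments_convergent)
  next
    case 2
    have AE: "AE y in \<mu>. ?f u y = of_bool u" for u
      using 2 by (rule AE_mp) (cases u; auto intro!: AE_I2 simp: g_def add_nonneg_eq_0_iff pmf_le_1)
    have m: "?m (density \<mu> p0) True = 1" "?m (density \<mu> p0) False = 0"
      "?m (density \<mu> p1) True = 1" "?m (density \<mu> p1) False = 0"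
    proof -
      interpret P0: prob_space "density \<mu> p0" using class_prob p_in_class by blast
      interpret P1: prob_space "density \<mu> p1" using class_prob p_in_class by blast
      have "?m (density \<mu> p) u = (LINT y|density \<mu> p. of_bool u)"
        if [measurable]: "p \<in> borel_measurable \<mu>" for p u
      proof (rule integral_cong_AE)
        show "AE y in density \<mu> p. ?f u y = of_bool u"
          using AE[of u] by (subst AE_density) (auto elim!: eventually_mono)
      qed (use f(1)[of u] in \<open>auto simp: tests_def\<close>)
      thus "?m (density \<mu> p0) True = 1" "?m (density \<mu> p0) False = 0"
        "?m (density \<mu> p1) True = 1" "?m (density \<mu> p1) False = 0"
        using P0.prob_space[simplified] P1.prob_space[simplified] by simp_all
    qed
    have "DD \<phi> (Suc n) \<le> DD \<phi> (Suc (Suc n))" for n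
    proof (rule DD_le[OF \<phi>])
      fix P P' :: "nat \<Rightarrow> 'a measure"
      assume P: "\<And>j. P j \<in> C0" and P': "\<And>j. P' j \<in> C1"
      \<comment> \<open>The last law has to be the nominal one: a contaminated law may charge the
        null set on which \<open>\<phi>\<close> does not copy. Hence only monotonicity is obtained,
        not constancy.\<close>
      let ?T = "P(Suc (Suc n) := density \<mu> p0)" and ?T' = "P'(Suc (Suc n) := density \<mu> p1)"
      have "traj \<phi>1 \<phi> ?T n = traj \<phi>1 \<phi> P n" "traj \<phi>1 \<phi> ?T' n = traj \<phi>1 \<phi> P' n"
        by (rule traj_cong; simp)+
      hence "traj \<phi>1 \<phi> ?T (Suc n) = traj \<phi>1 \<phi> P n" "traj \<phi>1 \<phi> ?T' (Suc n) = traj \<phi>1 \<phi> P' n"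
        by (simp_all add: m)
      thus "\<pi>0 * traj \<phi>1 \<phi> P n + \<pi>1 * (1 - traj \<phi>1 \<phi> P' n) \<le> DD \<phi> (Suc (Suc n))"
        using traj_le_DD[OF \<phi>, of ?T ?T' "Suc n"] P P' p_in_class by (simp del: traj.simps)
    qed
    moreover have "Bseq (\<lambda>n. DD \<phi> (Suc n))"
      using DD_unit[OF \<phi>] by (intro BseqI'[of _ 1]) auto
    ultimately show ?thesis by (intro Bseq_monoseq_convergent) (auto simp: monoseq_Suc)
  next
    case 3
    have AE: "AE y in \<mu>. ?f u y = of_bool (\<not> u)" for u
      using 3 by (rule AE_mp) (cases u; auto intro!: AE_I2 simp: h_def add_nonneg_eq_0_iff pmf_le_1)
    have int: "(LINT y|density \<mu> q. ?f u y) = (LINT y|density \<mu> q. of_bool (\<not> u))"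
      if [measurable]: "q \<in> borel_measurable \<mu>" for q u
    proof (rule integral_cong_AE)
      show "AE y in density \<mu> q. ?f u y = of_bool (\<not> u)"
        using AE[of u] by (subst AE_density) (auto elim!: eventually_mono)
    qed (use f(1)[of u] in \<open>auto simp: tests_def\<close>)
    have AD: "A \<phi> u = of_bool (\<not> u)" "D \<phi> u = of_bool (\<not> u)" for u
    proof -
      have "A \<phi> u = E0 (\<lambda>_. of_bool (\<not> u))" "D \<phi> u = E1 (\<lambda>_. of_bool (\<not> u))"
        unfolding A_def D_def E0_def E1_def by (rule int; measurable)+
      thus "A \<phi> u = of_bool (\<not> u)" "D \<phi> u = of_bool (\<not> u)"
        using const_tests(2,3)[of "of_bool (\<not> u)"] by (cases u; simp)+
    qed
    have err: "err 1 0 1 0 n \<le> DD \<phi> (Suc n)" for n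
      using err_le_DD[OF \<phi>, of n] by (simp add: AD)
    have half: "\<pi>0 + \<pi>1 = 1" "e1 \<le> \<pi>0" "e1 \<le> \<pi>1" using prior e1_le_prior by auto
    have neg: "(markov 1 0 x1 n = x1 \<and> markov 1 0 w1 n = w1) \<or>
      (markov 1 0 x1 n = 1 - x1 \<and> markov 1 0 w1 n = 1 - w1)" for n
      by (induction n) auto
    have flip: "\<pi>0 * (1 - x1) + \<pi>1 * (1 - (1 - w1)) = (\<pi>0 + \<pi>1) - e1"
      by (simp add: e1_def algebra_simps)
    have err_cases: "err 1 0 1 0 n = e1 \<or> err 1 0 1 0 n = 1 - e1" for n
      using neg[of n]
    proof (elim disjE conjE)
      assume "markov 1 0 x1 n = 1 - x1" "markov 1 0 w1 n = 1 - w1"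
      thus ?thesis using flip prior(3) by (simp only: err_def simp_thms)
    qed (simp add: err_def e1_def)
    have "err 1 0 1 0 1 = 1 - e1"
      using flip prior(3) by (simp add: err_def)
    \<comment> \<open>Negating the first decision gives agent 2 the Q-error \<open>1 - e1\<close>.
      In the other direction \<open>e1\<close> is at most both priors, hence at most 1/2.\<close>
    hence "1 - e1 \<le> e1"
      using err[of 1] DD_le_Pmax[OF \<phi>, of 1] Pmax by simp
    hence e1: "e1 = 1 / 2" using half by linarith
    have const: "DD \<phi> (Suc (Suc n)) = 1 / 2" for n
    proof (rule antisym)
      show "DD \<phi> (Suc (Suc n)) \<le> 1 / 2"
        using DD_le_Pmax[OF \<phi>, of "Suc n"] Pmax e1 by simp
      show "1 / 2 \<le> DD \<phi> (Suc (Suc n))"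
        using err[of "Suc n"] err_cases[of "Suc n"] e1 by linarith
    qed
    have "(\<lambda>n. DD \<phi> (Suc n)) \<longlonglongrightarrow> 1 / 2"
      by (rule LIMSEQ_imp_Suc) (simp add: const)
    thus ?thesis by (auto simp: convergent_def)
  qed
qed

text \<open>The formula holds for every minimizer, whatever its form, so it is separate from the
  existence of one that is a likelihood ratio test. Convergence is part of the claim because
  \<open>lim\<close> would otherwise be an arbitrary value.\<close>

theorem minimizers:
  "(\<exists>\<phi>. is_arg_min Pmax (\<lambda>\<phi>. \<phi> \<in> rules \<mu>) \<phi> \<and> randomized_LRT \<mu> q0 q1 \<phi>) \<and>
   (\<forall>\<phi>. is_arg_min Pmax (\<lambda>\<phi>. \<phi> \<in> rules \<mu>) \<phi> \<longrightarrow>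
      convergent (DD \<phi>) \<and> Pmax \<phi> = max (DD \<phi> 2) (Pinf_DD \<pi>0 \<pi>1 C0 C1 \<phi>1 \<phi>))"
proof (intro conjI allI impI)
  show "\<exists>\<phi>. is_arg_min Pmax (\<lambda>\<phi>. \<phi> \<in> rules \<mu>) \<phi> \<and> randomized_LRT \<mu> q0 q1 \<phi>"
    using minimizer_exists unfolding is_arg_min_def by (meson not_less)
  fix \<phi> assume "is_arg_min Pmax (\<lambda>\<phi>. \<phi> \<in> rules \<mu>) \<phi>"
  hence \<phi>: "\<phi> \<in> rules \<mu>" and min: "\<And>\<psi>. \<psi> \<in> rules \<mu> \<Longrightarrow> Pmax \<phi> \<le> Pmax \<psi>"
    unfolding is_arg_min_def by (meson not_less)+
  have "Pmax \<phi> \<le> e1" using min[OF copy_rule(1)] copy_rule(3) by simp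
  then obtain l where l: "(\<lambda>n. DD \<phi> (Suc n)) \<longlonglongrightarrow> l"
    using convergent_DD[OF \<phi>] by (auto simp: convergent_def)
  hence l': "DD \<phi> \<longlonglongrightarrow> l" by (rule LIMSEQ_imp_Suc)
  thus "convergent (DD \<phi>)" by (auto simp: convergent_def)
  have "Pinf_DD \<pi>0 \<pi>1 C0 C1 \<phi>1 \<phi> = l" unfolding Pinf_DD_def using l' by (rule limI)
  thus "Pmax \<phi> = max (DD \<phi> 2) (Pinf_DD \<pi>0 \<pi>1 C0 C1 \<phi>1 \<phi>)"
    using Pmax_minimizer[OF \<phi> min l] by simp
qed

end

section \<open>Contamination classes and least favorable distributions\<close>

lemma
  fixes p :: "'a \<Rightarrow> real"
  assumes [measurable]: "p \<in> borel_measurable M" and nonneg: "\<And>y. y \<in> space M \<Longrightarrow> 0 \<le> p y"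
    and "prob_space (density M p)"
  shows integrable_prob_density: "integrable M p"
    and integral_prob_density: "(LINT y|M. p y) = 1"
proof -
  interpret prob_space "density M p" by fact
  have AE: "AE y in M. 0 \<le> p y" using nonneg by (rule AE_I2)
  have "integrable (density M p) (\<lambda>_. 1 :: real)" by simp
  thus "integrable M p" using AE integrable_density[of "\<lambda>_. 1 :: real" M p] by simp
  have "(LINT y|density M p. (1 :: real)) = 1" using prob_space by simp
  thus "(LINT y|M. p y) = 1" using AE integral_density[of "\<lambda>_. 1 :: real" M p] by simp
qed

lemma measure_density_integral:
  fixes p :: "'a \<Rightarrow> real"
  assumes [measurable]: "p \<in> borel_measurable M" and nonneg: "\<And>y. y \<in> space M \<Longrightarrow> 0 \<le> p y"
    and A [measurable]: "A \<in> sets M"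
  shows "measure (density M p) A = (LINT y|M. p y * indicator A y)"
proof -
  have "AE y in M. 0 \<le> p y" using nonneg by (rule AE_I2)
  hence "(LINT y|density M p. indicator A y :: real) = (LINT y|M. p y * indicator A y)"
    using integral_density[of "indicator A :: 'a \<Rightarrow> real" M p] by simp
  thus ?thesis using sets.sets_into_space[OF A] by (simp add: Int_absorb2)
qed

lemma measure_density_scaled:
  fixes p q :: "'a \<Rightarrow> real"
  assumes "p \<in> borel_measurable M" "q \<in> borel_measurable M"
    and "\<And>y. y \<in> space M \<Longrightarrow> 0 \<le> p y" "\<And>y. y \<in> space M \<Longrightarrow> 0 \<le> q y"
    and "A \<in> sets M" "\<And>y. y \<in> A \<Longrightarrow> q y = c * p y"
  shows "measure (density M q) A = c * measure (density M p) A"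
proof -
  have "(LINT y|M. q y * indicator A y) = (LINT y|M. c * (p y * indicator A y))"
    using assms(6) by (intro Bochner_Integration.integral_cong refl) (auto simp: indicator_def)
  thus ?thesis using assms by (simp add: measure_density_integral)
qed

text \<open>The difference of the densities is nonnegative with integral 0.\<close>

lemma prob_densities_le_eq:
  fixes p q :: "'a \<Rightarrow> real"
  assumes [measurable]: "p \<in> borel_measurable M" "q \<in> borel_measurable M"
    and nonneg: "\<And>y. y \<in> space M \<Longrightarrow> 0 \<le> p y" and le: "\<And>y. y \<in> space M \<Longrightarrow> p y \<le> q y"
    and prob: "prob_space (density M p)" "prob_space (density M q)"
  shows "density M p = density M q"
proof -
  have q: "0 \<le> q y" if "y \<in> space M" for y using nonneg le that order_trans by blast
  note i = integrable_prob_density[OF _ nonneg prob(1)] integrable_prob_density[OF _ q prob(2)]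
  have "(LINT y|M. q y - p y) = 0"
    using i integral_prob_density[OF _ nonneg prob(1)] integral_prob_density[OF _ q prob(2)] by simp
  hence "AE y in M. q y - p y = 0"
    using i le by (subst (asm) integral_nonneg_eq_0_iff_AE) (auto intro!: AE_I2)
  hence "AE y in M. ennreal (p y) = ennreal (q y)" by (elim AE_mp) (auto intro!: AE_I2)
  thus ?thesis by (intro density_cong) auto
qed

text \<open>The contaminating law has the normalized remainder
  \<open>(q - (1 - \<epsilon>) * p) / \<epsilon>\<close> as density. For
  \<open>\<epsilon> = 0\<close> the ordered densities must agree almost everywhere.\<close>

lemma contamination_class_memI:
  fixes p q :: "'a \<Rightarrow> real"
  assumes meas [measurable]: "p \<in> borel_measurable M" "q \<in> borel_measurable M"
    and \<epsilon>: "0 \<le> \<epsilon>" "\<epsilon> < 1"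
    and p: "\<And>y. y \<in> space M \<Longrightarrow> 0 \<le> p y" and le: "\<And>y. y \<in> space M \<Longrightarrow> (1 - \<epsilon>) * p y \<le> q y"
    and prob: "prob_space (density M p)" "prob_space (density M q)"
  shows "density M q \<in> contamination_class M \<epsilon> (density M p)"
proof -
  have q: "0 \<le> q y" if "y \<in> space M" for y
  proof -
    have "0 \<le> (1 - \<epsilon>) * p y" using \<epsilon> p[OF that] by simp
    thus ?thesis using le[OF that] by linarith
  qed
  note i = integrable_prob_density[OF meas(1) p prob(1)] integrable_prob_density[OF meas(2) q prob(2)]
  have "\<exists>R. prob_space R \<and> sets R = sets M \<and>
    (\<forall>A\<in>sets M. measure (density M q) A = (1 - \<epsilon>) * measure (density M p) A + \<epsilon> * measure R A)"
  proof (cases "\<epsilon> = 0")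
    case True
    hence "density M p = density M q"
      using le by (intro prob_densities_le_eq p prob) auto
    thus ?thesis using True prob by (intro exI[of _ "density M p"]) auto
  next
    case False
    define r where "r y = (q y - (1 - \<epsilon>) * p y) / \<epsilon>" for y
    have r_meas [measurable]: "r \<in> borel_measurable M" unfolding r_def by measurable
    have r: "0 \<le> r y" if "y \<in> space M" for y using \<epsilon> le[OF that] by (simp add: r_def)
    have r_int: "integrable M r" unfolding r_def using i by auto
    have r_one: "(LINT y|M. r y) = 1"
      unfolding r_def using i integral_prob_density[OF meas(1) p prob(1)]
        integral_prob_density[OF meas(2) q prob(2)] False by simp
    have "prob_space (density M r)"
    proof (rule prob_spaceI)
      have "emeasure (density M r) (space (density M r)) = (\<integral>\<^sup>+ y. ennreal (r y) \<partial>M)"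
        by (simp add: emeasure_density cong: nn_integral_cong)
      also have "\<dots> = 1"
        using r by (subst nn_integral_eq_integral[OF r_int]) (auto simp: r_one)
      finally show "emeasure (density M r) (space (density M r)) = 1" .
    qed
    moreover have "measure (density M q) A = (1 - \<epsilon>) * measure (density M p) A + \<epsilon> * measure (density M r) A"
      if A [measurable]: "A \<in> sets M" for A
    proof -
      have "(LINT y|M. q y * indicator A y) =
          (LINT y|M. (1 - \<epsilon>) * (p y * indicator A y) + \<epsilon> * (r y * indicator A y))"
        using False by (intro Bochner_Integration.integral_cong refl) (simp add: r_def field_simps)
      also have "\<dots> = (1 - \<epsilon>) * (LINT y|M. p y * indicator A y) + \<epsilon> * (LINT y|M. r y * indicator A y)"
        using i(1) r_int by (simp add: integrable_real_mult_indicator)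
      finally show ?thesis
        using measure_density_integral[OF meas(1) p A] measure_density_integral[OF meas(2) q A]
          measure_density_integral[OF r_meas r A] by simp
    qed
    ultimately show ?thesis by (intro exI[of _ "density M r"]) auto
  qed
  thus ?thesis using prob by (simp add: contamination_class_def)
qed

lemma contamination_classD:
  assumes "P \<in> contamination_class M \<epsilon> N" "0 \<le> \<epsilon>"
  shows "prob_space P" "sets P = sets M" "A \<in> sets M \<Longrightarrow> (1 - \<epsilon>) * measure N A \<le> measure P A"
  using assms by (auto simp: contamination_class_def)

text \<open>Dropping the contaminating part leaves a scaled nominal measure below \<open>P\<close>,
  and an inequality of measures passes to integrals of nonnegative functions.\<close>

lemma contamination_class_integral_ge:
  fixes f :: "'a \<Rightarrow> real"
  assumes P: "P \<in> contamination_class M \<epsilon> N" and \<epsilon>: "0 \<le> \<epsilon>" "\<epsilon> < 1"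
    and N: "prob_space N" "sets N = sets M"
    and f: "f \<in> borel_measurable M" "\<And>y. 0 \<le> f y" "\<And>y. f y \<le> 1"
  shows "(1 - \<epsilon>) * (LINT y|N. f y) \<le> (LINT y|P. f y)"
proof -
  note PD = contamination_classD[OF P \<epsilon>(1)]
  interpret P: prob_space P by (rule PD)
  interpret N: prob_space N by (rule N)
  have meas: "f \<in> borel_measurable P" "f \<in> borel_measurable N"
    using f(1) PD(2) N(2) by (simp_all cong: measurable_cong_sets)
  have int: "integrable P f" "integrable N f"
    using meas f(2,3) by (auto intro!: P.integrable_const_bound[of _ 1] N.integrable_const_bound[of _ 1])
  have "scale_measure (ennreal (1 - \<epsilon>)) N \<le> P"
  proof (subst le_measure)
    show "\<forall>A\<in>sets (scale_measure (ennreal (1 - \<epsilon>)) N). emeasure (scale_measure (ennreal (1 - \<epsilon>)) N) A \<le> emeasure P A"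
      using PD(3) N(2) \<epsilon>
      by (auto simp: P.emeasure_eq_measure N.emeasure_eq_measure simp flip: ennreal_mult)
  qed (use PD N in simp)
  hence "nn_integral (scale_measure (ennreal (1 - \<epsilon>)) N) (\<lambda>y. ennreal (f y)) \<le> nn_integral P (\<lambda>y. ennreal (f y))"
    using PD N by (intro nn_integral_mono_measure) auto
  hence "ennreal ((1 - \<epsilon>) * (LINT y|N. f y)) \<le> ennreal (LINT y|P. f y)"
    using meas int f(2) \<epsilon>
    by (simp add: nn_integral_scale_measure nn_integral_eq_integral ennreal_mult' del: ennreal_le_iff)
  thus ?thesis using f(2) by simp
qed

section \<open>The least favorable pair and its clipped likelihood ratio\<close>

locale least_favorable =
  fixes \<mu> :: "'a measure" and p0 p1 q0 q1 :: "'a \<Rightarrow> real" and \<epsilon>0 \<epsilon>1 c' :: real and c'' :: ereal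
  assumes p_meas [measurable]: "p0 \<in> borel_measurable \<mu>" "p1 \<in> borel_measurable \<mu>"
    and p_pos: "\<And>y. y \<in> space \<mu> \<Longrightarrow> 0 < p0 y" "\<And>y. y \<in> space \<mu> \<Longrightarrow> 0 < p1 y"
    and p_prob: "prob_space (density \<mu> p0)" "prob_space (density \<mu> p1)"
    and eps: "0 \<le> \<epsilon>0" "\<epsilon>0 < 1" "0 \<le> \<epsilon>1" "\<epsilon>1 < 1"
    and q_def: "q0 = lfd_q0 \<epsilon>0 c'' p0 p1" "q1 = lfd_q1 \<epsilon>1 c' p0 p1"
    and c: "0 \<le> c'" "ereal c' < c''"
    and q_prob: "prob_space (density \<mu> q0)" "prob_space (density \<mu> q1)"
begin

definition ratio :: "'a \<Rightarrow> real" where "ratio y = p1 y / p0 y"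

definition "b = (1 - \<epsilon>1) / (1 - \<epsilon>0)"

lemma b_pos: "0 < b" using eps by (simp add: b_def)

lemma ratio_pos: "y \<in> space \<mu> \<Longrightarrow> 0 < ratio y"
  using p_pos by (simp add: ratio_def)

lemma ratio_meas [measurable]: "ratio \<in> borel_measurable \<mu>"
  unfolding ratio_def by measurable

lemma q0_eq: "q0 y = (if ereal (ratio y) < c'' then (1 - \<epsilon>0) * p0 y else (1 - \<epsilon>0) * p1 y / real_of_ereal c'')"
  by (simp add: q_def lfd_q0_def ratio_def)

lemma q1_eq: "q1 y = (if c' < ratio y then (1 - \<epsilon>1) * p1 y else c' * (1 - \<epsilon>1) * p0 y)"
  by (simp add: q_def lfd_q1_def ratio_def)

lemma q_meas [measurable]: "q0 \<in> borel_measurable \<mu>" "q1 \<in> borel_measurable \<mu>"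
  unfolding q0_eq[abs_def] q1_eq[abs_def] by measurable

text \<open>A finite ratio can reach \<open>c''\<close> only if \<open>c''\<close> is finite, so
  \<open>real_of_ereal\<close> never returns its default value in the second branch of
  \<open>lfd_q0\<close>.\<close>

lemma c''_real:
  assumes "\<not> ereal (ratio y) < c''"
  shows "ereal (real_of_ereal c'') = c''" "c' < real_of_ereal c''" "real_of_ereal c'' \<le> ratio y"
  using assms c by (cases c''; simp)+

lemma q_pos:
  assumes y: "y \<in> space \<mu>"
  shows "0 < q0 y" "0 < q1 y"
proof -
  show "0 < q0 y"
  proof (cases "ereal (ratio y) < c''")
    case False
    hence "0 < real_of_ereal c''" using c''_real(2)[OF False] c by simp
    thus ?thesis using False p_pos[OF y] eps by (simp add: q0_eq)
  qed (use p_pos[OF y] eps in \<open>simp add: q0_eq\<close>)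
  show "0 < q1 y"
    using p_pos[OF y] eps c ratio_pos[OF y] by (auto simp: q1_eq not_less intro!: mult_pos_pos)
qed

lemma q_ge:
  assumes y: "y \<in> space \<mu>"
  shows "(1 - \<epsilon>0) * p0 y \<le> q0 y" "(1 - \<epsilon>1) * p1 y \<le> q1 y"
proof -
  show "(1 - \<epsilon>0) * p0 y \<le> q0 y"
  proof (cases "ereal (ratio y) < c''")
    case False
    note r = c''_real[OF False]
    have "real_of_ereal c'' * p0 y \<le> p1 y"
      using r(3) p_pos[OF y] by (simp add: ratio_def field_simps)
    hence "p0 y \<le> p1 y / real_of_ereal c''"
      using r(2) c by (simp add: field_simps)
    hence "(1 - \<epsilon>0) * p0 y \<le> (1 - \<epsilon>0) * (p1 y / real_of_ereal c'')"
      using eps by (intro mult_left_mono) auto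
    thus ?thesis using False by (simp add: q0_eq)
  qed (simp add: q0_eq)
  show "(1 - \<epsilon>1) * p1 y \<le> q1 y"
  proof (cases "c' < ratio y")
    case False
    hence "p1 y \<le> c' * p0 y" using p_pos[OF y] by (simp add: ratio_def field_simps)
    hence "(1 - \<epsilon>1) * p1 y \<le> (1 - \<epsilon>1) * (c' * p0 y)"
      using eps by (intro mult_left_mono) auto
    thus ?thesis using False by (simp add: q1_eq mult_ac)
  qed (simp add: q1_eq)
qed

text \<open>Since \<open>c' < c''\<close>, at most one of the two densities departs from its nominal
  part at a given point, and this departure clips the nominal ratio at \<open>c'\<close> or
  \<open>c''\<close>. The factor \<open>b\<close> is the quotient of the nominal weights.\<close>

lemma likelihood_ratio:
  assumes y: "y \<in> space \<mu>"
  shows "q1 y / q0 y = b * (if ratio y \<le> c' then c' else if ereal (ratio y) < c'' then ratio y else real_of_ereal c'')"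
proof -
  consider "ratio y \<le> c'" "ereal (ratio y) < c''" | "c' < ratio y" "ereal (ratio y) < c''"
    | "c' < ratio y" "\<not> ereal (ratio y) < c''"
    using c by (metis ereal_less_eq(3) le_less_trans not_less)
  thus ?thesis
  proof cases
    case 3
    thus ?thesis
      using p_pos[OF y] eps c''_real[OF 3(2)] c by (simp add: q0_eq q1_eq b_def)
  qed (use p_pos[OF y] eps in \<open>simp_all add: q0_eq q1_eq b_def ratio_def\<close>)
qed

text \<open>Hence the contaminating part of \<open>Q0\<close> sits where \<open>l\<^sup>*\<close> is maximal, that of \<open>Q1\<close> where it is minimal.\<close>

lemma likelihood_ratio_max:
  assumes "y \<in> space \<mu>" "z \<in> space \<mu>" "\<not> ereal (ratio y) < c''"
  shows "q1 z / q0 z \<le> q1 y / q0 y"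
proof -
  note r = c''_real[OF assms(3)]
  have z: "ratio z < real_of_ereal c''" if "ereal (ratio z) < c''"
    using that r(1) by (metis ereal_less_eq(3) not_le)
  show ?thesis
    unfolding likelihood_ratio[OF assms(1)] likelihood_ratio[OF assms(2)]
    using b_pos assms(3) r z by (intro mult_left_mono) auto
qed

lemma likelihood_ratio_min:
  assumes "y \<in> space \<mu>" "z \<in> space \<mu>" "ratio y \<le> c'"
  shows "q1 y / q0 y \<le> q1 z / q0 z"
  unfolding likelihood_ratio[OF assms(1)] likelihood_ratio[OF assms(2)]
  using b_pos assms(3) c''_real(2)[of z] by (intro mult_left_mono) (auto intro: less_imp_le)

lemma densities_nonneg:
  "y \<in> space \<mu> \<Longrightarrow> 0 \<le> p0 y" "y \<in> space \<mu> \<Longrightarrow> 0 \<le> p1 y"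
  "y \<in> space \<mu> \<Longrightarrow> 0 \<le> q0 y" "y \<in> space \<mu> \<Longrightarrow> 0 \<le> q1 y"
  using p_pos q_pos by (simp_all add: less_imp_le)

abbreviation "C0 \<equiv> contamination_class \<mu> \<epsilon>0 (density \<mu> p0)"
abbreviation "C1 \<equiv> contamination_class \<mu> \<epsilon>1 (density \<mu> p1)"

lemma lfd_in_class: "density \<mu> q0 \<in> C0" "density \<mu> q1 \<in> C1"
  by (intro contamination_class_memI p_meas q_meas eps densities_nonneg p_prob q_prob q_ge; assumption)+

lemma nominal_in_class: "density \<mu> p0 \<in> C0" "density \<mu> p1 \<in> C1"
  using eps densities_nonneg
  by (auto intro!: contamination_class_memI p_meas p_prob mult_left_le_one_le)

text \<open>Where \<open>q0\<close> exceeds its nominal part the likelihood ratio is maximal, so a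
  nonempty upper set contains all such points; its complement then has the least mass that the class
  allows. Dually, an upper set either is the whole space or avoids the points where
  \<open>q1\<close> is clipped.\<close>

lemma upper_set_extremal:
  assumes S [measurable]: "S \<in> sets \<mu>"
    and up: "\<And>y z. y \<in> S \<Longrightarrow> z \<in> space \<mu> \<Longrightarrow> q1 y / q0 y \<le> q1 z / q0 z \<Longrightarrow> z \<in> S"
  shows "P \<in> C0 \<Longrightarrow> measure P S \<le> measure (density \<mu> q0) S"
    and "P \<in> C1 \<Longrightarrow> measure (density \<mu> q1) S \<le> measure P S"
proof -
  have S_space: "S \<subseteq> space \<mu>" using sets.sets_into_space[OF S] .
  show "measure P S \<le> measure (density \<mu> q0) S" if P: "P \<in> C0"
  proof (cases "\<exists>y\<in>space \<mu> - S. \<not> ereal (ratio y) < c''")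
    case True
    then obtain y where y: "y \<in> space \<mu>" "y \<notin> S" "\<not> ereal (ratio y) < c''" by auto
    have "S = {}" using up likelihood_ratio_max[OF y(1) _ y(3)] y S_space by blast
    thus ?thesis by simp
  next
    case False
    note PD = contamination_classD[OF P eps(1)]
    interpret P: prob_space P by (rule PD)
    interpret Q: prob_space "density \<mu> q0" by (rule q_prob)
    have "measure (density \<mu> q0) (space \<mu> - S) = (1 - \<epsilon>0) * measure (density \<mu> p0) (space \<mu> - S)"
      using False densities_nonneg by (intro measure_density_scaled) (auto simp: q0_eq)
    also have "\<dots> \<le> measure P (space \<mu> - S)" by (rule PD(3)) auto
    finally show ?thesis
      using P.prob_compl[of S] Q.prob_compl[of S] S PD(2) sets_eq_imp_space_eq[OF PD(2)] by simp
  qed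
  show "measure (density \<mu> q1) S \<le> measure P S" if P: "P \<in> C1"
  proof (cases "\<exists>y\<in>S. ratio y \<le> c'")
    case True
    then obtain y where y: "y \<in> S" "ratio y \<le> c'" by auto
    have "S = space \<mu>" using up[OF y(1)] likelihood_ratio_min[OF _ _ y(2)] y S_space by blast
    thus ?thesis
      using prob_space.prob_space[OF q_prob(2)] prob_space.prob_space[OF contamination_classD(1)[OF P eps(3)]]
        sets_eq_imp_space_eq[OF contamination_classD(2)[OF P eps(3)]] by simp
  next
    case False
    hence "measure (density \<mu> q1) S = (1 - \<epsilon>1) * measure (density \<mu> p1) S"
      using densities_nonneg by (intro measure_density_scaled) (auto simp: q1_eq not_le)
    also have "\<dots> \<le> measure P S" by (rule contamination_classD(3)[OF P eps(3) S])
    finally show ?thesis .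
  qed
qed

sublocale test_pair \<mu> q0 q1
  by (rule test_pair.intro) (fact q_meas q_pos q_prob)+

text \<open>A randomized threshold test is a mixture of the indicators of two upper sets, the strict
  and the weak one, which reduces its extremality to that of sets.\<close>

lemma integral_thr:
  assumes P: "prob_space P" "sets P = sets \<mu>"
  shows "(LINT y|P. thr t r y) = (1 - r) * measure P {y \<in> space \<mu>. t < ereal (q1 y / q0 y)} +
    r * measure P {y \<in> space \<mu>. t \<le> ereal (q1 y / q0 y)}" (is "_ = (1 - r) * measure P ?A + r * measure P ?B")
proof -
  interpret prob_space P by fact
  have [measurable_cong]: "sets P = sets \<mu>" by fact
  have AB [measurable]: "?A \<in> sets P" "?B \<in> sets P" unfolding P(2) by measurable
  have "(LINT y|P. thr t r y) = (LINT y|P. (1 - r) * indicator ?A y + r * indicator ?B y)"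
    using sets_eq_imp_space_eq[OF P(2)]
    by (intro Bochner_Integration.integral_cong refl) (auto simp: thr_def indicator_def)
  also have "\<dots> = (1 - r) * measure P ?A + r * measure P ?B"
    using AB sets.sets_into_space[OF AB(1)] sets.sets_into_space[OF AB(2)]
    by (simp add: Int_absorb2 emeasure_eq_measure)
  finally show ?thesis .
qed

lemma thr_extremal:
  assumes r: "r \<in> {0..1}"
  shows "P \<in> C0 \<Longrightarrow> (LINT y|P. thr t r y) \<le> E0 (thr t r)"
    and "P \<in> C1 \<Longrightarrow> E1 (thr t r) \<le> (LINT y|P. thr t r y)"
proof -
  have S: "{y \<in> space \<mu>. t < ereal (q1 y / q0 y)} \<in> sets \<mu>" "{y \<in> space \<mu>. t \<le> ereal (q1 y / q0 y)} \<in> sets \<mu>"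
    by measurable
  have up: "\<And>y z. y \<in> {y \<in> space \<mu>. t < ereal (q1 y / q0 y)} \<Longrightarrow> z \<in> space \<mu> \<Longrightarrow>
      q1 y / q0 y \<le> q1 z / q0 z \<Longrightarrow> z \<in> {y \<in> space \<mu>. t < ereal (q1 y / q0 y)}"
    "\<And>y z. y \<in> {y \<in> space \<mu>. t \<le> ereal (q1 y / q0 y)} \<Longrightarrow> z \<in> space \<mu> \<Longrightarrow>
      q1 y / q0 y \<le> q1 z / q0 z \<Longrightarrow> z \<in> {y \<in> space \<mu>. t \<le> ereal (q1 y / q0 y)}"
    by (auto intro: less_le_trans order_trans simp del: less_ereal.simps)
  show "(LINT y|P. thr t r y) \<le> E0 (thr t r)" if P: "P \<in> C0"
    unfolding E0_def integral_thr[OF contamination_classD(1,2)[OF P eps(1)]]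
      integral_thr[OF q_prob(1) sets_density]
    using r upper_set_extremal(1)[OF S(1) up(1) P] upper_set_extremal(1)[OF S(2) up(2) P]
    by (intro add_mono mult_left_mono) auto
  show "E1 (thr t r) \<le> (LINT y|P. thr t r y)" if P: "P \<in> C1"
    unfolding E1_def integral_thr[OF contamination_classD(1,2)[OF P eps(3)]]
      integral_thr[OF q_prob(2) sets_density]
    using r upper_set_extremal(2)[OF S(1) up(1) P] upper_set_extremal(2)[OF S(2) up(2) P]
    by (intro add_mono mult_left_mono) auto
qed

text \<open>The ratio \<open>q1 / q0\<close> may have atoms at its extreme values only, and these differ from 1
  because \<open>Q0 \<noteq> Q1\<close>.\<close>

lemma tie_null:
  assumes disjoint: "C0 \<inter> C1 = {}"
    and cont: "\<And>t. measure (density \<mu> p0) {y \<in> space \<mu>. p1 y / p0 y = t} = 0"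
  shows "E0 (thr 1 r) = E0 (thr 1 r')"
proof -
  interpret P: prob_space "density \<mu> p0" by (rule p_prob)
  have ne: "density \<mu> q0 \<noteq> density \<mu> q1" using disjoint lfd_in_class by auto
  \<comment> \<open>Ordered probability densities would coincide almost everywhere, so the
    likelihood ratio takes values on both sides of 1. At a point where it equals 1 neither clipping
    is active, which pins the nominal ratio to \<open>1 / b\<close>.\<close>
  have "\<not> (\<forall>y\<in>space \<mu>. q0 y \<le> q1 y)"
    using ne prob_densities_le_eq[OF q_meas densities_nonneg(3) _ q_prob] by blast
  then obtain y0 where y0: "y0 \<in> space \<mu>" "q1 y0 / q0 y0 < 1"
    using q_pos by (auto simp: not_le)
  have "\<not> (\<forall>y\<in>space \<mu>. q1 y \<le> q0 y)"
    using ne prob_densities_le_eq[OF q_meas(2,1) densities_nonneg(4) _ q_prob(2,1)] by fastforce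
  then obtain y1 where y1: "y1 \<in> space \<mu>" "1 < q1 y1 / q0 y1"
    using q_pos by (auto simp: not_le)
  have "ratio y = 1 / b" if y: "y \<in> space \<mu>" "q1 y / q0 y = 1" for y
  proof -
    have "\<not> ratio y \<le> c'" using likelihood_ratio_min[OF y(1) y0(1)] y0(2) y(2) by auto
    moreover have "ereal (ratio y) < c''" using likelihood_ratio_max[OF y(1) y1(1)] y1(2) y(2) by auto
    ultimately show ?thesis using likelihood_ratio[OF y(1)] y(2) b_pos by (simp add: field_simps)
  qed
  moreover have "AE y in \<mu>. ratio y \<noteq> 1 / b"
  proof -
    have "AE y in density \<mu> p0. \<not> ratio y = 1 / b"
      using cont[of "1 / b"] by (subst AE_iff_measurable[OF _ refl])
        (auto simp: P.emeasure_eq_measure ratio_def)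
    thus ?thesis using p_pos by (auto simp: AE_density elim!: AE_mp intro!: AE_I2)
  qed
  ultimately have "AE y in \<mu>. q1 y / q0 y \<noteq> 1" by (elim AE_mp) (auto intro!: AE_I2)
  hence AE: "AE y in density \<mu> q0. thr 1 r y = thr 1 r' y"
    by (subst AE_density) (auto simp: thr_def one_ereal_def elim!: eventually_mono)
  show ?thesis
    unfolding E0_def
  proof (rule integral_cong_AE[OF _ _ AE])
    show "thr 1 r \<in> borel_measurable (density \<mu> q0)" "thr 1 r' \<in> borel_measurable (density \<mu> q0)"
      unfolding thr_def by measurable
  qed
qed

end

theorem theorem7:
  fixes \<mu> P0s P1s :: "'a measure"
    and p0 p1 q0 q1 :: "'a \<Rightarrow> real"
    and \<epsilon>0 \<epsilon>1 \<pi>0 \<pi>1 c' :: real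
    and c'' :: ereal
    and C0 C1 :: "'a measure set"
    and \<phi>1 :: "'a \<Rightarrow> bool pmf"
  assumes prior: "0 < \<pi>0" "0 < \<pi>1" "\<pi>0 + \<pi>1 = 1"
    and nominal_prob: "prob_space P0s" "prob_space P1s"
    and nominal_ac: "absolutely_continuous P0s P1s" "absolutely_continuous P1s P0s"
    and density_meas: "p0 \<in> borel_measurable \<mu>" "p1 \<in> borel_measurable \<mu>"
    and density_pos: "\<And>y. y \<in> space \<mu> \<Longrightarrow> 0 < p0 y" "\<And>y. y \<in> space \<mu> \<Longrightarrow> 0 < p1 y"
    and nominal_density: "P0s = density \<mu> p0" "P1s = density \<mu> p1"
    and contamination: "0 \<le> \<epsilon>0" "\<epsilon>0 < 1" "0 \<le> \<epsilon>1" "\<epsilon>1 < 1"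
    and classes: "C0 = contamination_class \<mu> \<epsilon>0 P0s" "C1 = contamination_class \<mu> \<epsilon>1 P1s"
    and disjoint_classes: "C0 \<inter> C1 = {}"
    and lfd: "q0 = lfd_q0 \<epsilon>0 c'' p0 p1" "q1 = lfd_q1 \<epsilon>1 c' p0 p1"
    and lfd_constants: "0 \<le> c'" "ereal c' < c''"
      "prob_space (density \<mu> q0)" "prob_space (density \<mu> q1)"
    and lr_continuous:
      "\<And>t. measure P0s {y \<in> space \<mu>. p1 y / p0 y = t} = 0"
      "\<And>t. measure P1s {y \<in> space \<mu>. p1 y / p0 y = t} = 0"
    and agent1: "is_arg_min (P1_SL \<pi>0 \<pi>1 C0 C1) (\<lambda>\<psi>. \<psi> \<in> rules1 \<mu>) \<phi>1"
  shows "(\<exists>\<phi>. is_arg_min (Pmax_SL \<pi>0 \<pi>1 C0 C1 \<phi>1) (\<lambda>\<phi>. \<phi> \<in> rules \<mu>) \<phi> \<and>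
              randomized_LRT \<mu> q0 q1 \<phi>) \<and>
         (\<forall>\<phi>. is_arg_min (Pmax_SL \<pi>0 \<pi>1 C0 C1 \<phi>1) (\<lambda>\<phi>. \<phi> \<in> rules \<mu>) \<phi> \<longrightarrow>
              convergent (\<lambda>k. P_DD \<pi>0 \<pi>1 C0 C1 \<phi>1 \<phi> k) \<and>
              Pmax_SL \<pi>0 \<pi>1 C0 C1 \<phi>1 \<phi> =
                max (P_SL \<pi>0 \<pi>1 C0 C1 \<phi>1 \<phi> 2) (Pinf_DD \<pi>0 \<pi>1 C0 C1 \<phi>1 \<phi>))"
proof -
  interpret L: least_favorable \<mu> p0 p1 q0 q1 \<epsilon>0 \<epsilon>1 c' c''
    by (rule least_favorable.intro)
      (fact density_meas density_pos contamination lfd lfd_constants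
        nominal_prob[unfolded nominal_density])+
  have C: "C0 = L.C0" "C1 = L.C1" using classes nominal_density by auto
  define \<kappa> where "\<kappa> = min (1 - \<epsilon>0) (1 - \<epsilon>1)"
  have lower: "\<kappa> * (LINT y|density \<mu> p. f y) \<le> (LINT y|P. f y)"
    if "P \<in> contamination_class \<mu> \<epsilon> (density \<mu> p)" "0 \<le> \<epsilon>" "\<epsilon> < 1" "\<kappa> \<le> 1 - \<epsilon>"
      "prob_space (density \<mu> p)" "f \<in> L.tests" for P p \<epsilon> and f :: "'a \<Rightarrow> real"
  proof -
    have f: "f \<in> borel_measurable \<mu>" "0 \<le> f y" "f y \<le> 1" for y
      using that(6) by (auto simp: L.tests_def)
    have "\<kappa> * (LINT y|density \<mu> p. f y) \<le> (1 - \<epsilon>) * (LINT y|density \<mu> p. f y)"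
      using that(4) f(2) by (intro mult_right_mono) auto
    also have "\<dots> \<le> (LINT y|P. f y)"
      using that f by (intro contamination_class_integral_ge) auto
    finally show ?thesis .
  qed
  have L_prior: "robust_pair_axioms \<mu> q0 q1 C0 C1 \<pi>0 \<pi>1 \<phi>1"
  proof (rule robust_pair_axioms.intro)
    show "prob_space P \<and> sets P = sets \<mu>" if "P \<in> C0 \<union> C1" for P
      using that contamination_classD(1,2)[of P] contamination(1,3) unfolding C by auto
    show "density \<mu> q0 \<in> C0" "density \<mu> q1 \<in> C1"
      unfolding C by (fact L.lfd_in_class)+
    show "(LINT y|P. L.thr t r y) \<le> L.E0 (L.thr t r)" if "P \<in> C0" "r \<in> {0..1}" for P t r
      using L.thr_extremal(1) that unfolding C by blast
    show "L.E1 (L.thr t r) \<le> (LINT y|P. L.thr t r y)" if "P \<in> C1" "r \<in> {0..1}" for P t r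
      using L.thr_extremal(2) that unfolding C by blast
    show "L.E0 (L.thr 1 r) = L.E0 (L.thr 1 r')" for r r'
      using disjoint_classes lr_continuous(1) unfolding C nominal_density by (rule L.tie_null)
  qed (fact prior agent1)+
  interpret R: robust_nominal \<mu> q0 q1 C0 C1 \<pi>0 \<pi>1 \<phi>1 p0 p1 \<kappa>
  proof (intro robust_nominal.intro robust_pair.intro robust_nominal_axioms.intro L_prior L.test_pair_axioms)
    show "density \<mu> p0 \<in> C0" "density \<mu> p1 \<in> C1"
      unfolding C by (fact L.nominal_in_class)+
    show "0 < \<kappa>" using contamination by (simp add: \<kappa>_def)
    show "\<kappa> * (LINT y|density \<mu> p0. f y) \<le> (LINT y|P. f y)" if "P \<in> C0" "f \<in> L.tests" for P f
      by (rule lower[OF that(1)[unfolded C]]) (use that(2) contamination L.p_prob in \<open>auto simp: \<kappa>_def\<close>)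
    show "\<kappa> * (LINT y|density \<mu> p1. f y) \<le> (LINT y|P. f y)" if "P \<in> C1" "f \<in> L.tests" for P f
      by (rule lower[OF that(1)[unfolded C]]) (use that(2) contamination L.p_prob in \<open>auto simp: \<kappa>_def\<close>)
  qed (fact density_meas density_pos)+
  show ?thesis by (rule R.minimizers)
qed

end
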